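(* Let $B$ be an edge-clean, trail-reachable bidirected graph rooted at $r$, let $D=D_B^{\mathrm{trail}}$ be its trail-skeleton, and let $x\in V(D)$. Then $\lambda_B^{\mathrm{trail}}(r,x)=\lambda_D(r,x)$. Furthermore, if $B$ is path-reachable, then $\lambda_B^{\mathrm{path}}(r,x)=\lambda_D(r,x)$.
   Context: All graphs are finite. A bidirected graph $B=(G,\sigma)$ is a loopless multigraph $G$ together with a map $\sigma$ assigning to each half-edge $(e,u)$ ($u$ an endpoint of the edge $e$) a sign $\sigma(e,u)\in\{+,-\}$. An oriented edge $\vec e$ is an edge $e$ with a choice of which endpoint is its tail and which its head; $\overleftarrow{e}$ is the opposite orientation. A trail is a sequence $v_0\vec e_1v_1\dots\vec e_\ell v_\ell$ in which the edges $e_i$ are pairwise distinct, $\vec e_i$ has tail $v_{i-1}$ and head $v_i$, and $\sigma(e_{i+1},v_i)=-\sigma(e_i,v_i)$ for $1\le i<\ell$; it is a $v_0$--$v_\ell$ trail, trivial if $\ell=0$. A path is a trail that does not repeat vertices. Two trails are edge-disjoint if they share no underlying edge. $B$ is rooted if it has a designated root vertex $r$. An $r$-trail is a trail starting in $r$ with no internal vertex equal to $r$. An $r$--$\vec e$ trail (path) is an $r$-trail (path starting in $r$) whose last oriented edge is $\vec e$; an $r$--$e$ trail (path) is an $r$--$\vec e$ trail (path) for either orientation $\vec e$ of $e$. $B$ is trail-reachable (path-reachable) if for every edge $e$ there is an $r$--$e$ trail ($r$--$e$ path). An edge $e$ is trail-undirectable if there are both an $r$--$\vec e$ trail and an $r$--$\overleftarrow{e}$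 trail; it is trail-directable if exactly one orientation $\vec e$ of $e$ admits an $r$--$\vec e$ trail, and this $\vec e$ is the natural orientation of $e$. The trail-undirectable components $C_1,\dots,C_k$ of $B$ are the connected components (having at least one edge) of the subgraph formed by the trail-undirectable edges. $B$ is edge-clean if $r$ lies in no trail-undirectable component. Trail-skeleton (for trail-reachable $B$): for a component $C_i$ with $r\notin V(C_i)$ there is exactly one trail-directable edge $f_i$ whose natural orientation has its head in $V(C_i)$; let $c_i$ be this head. If $r\in V(C_i)$, let $c_i:=r$. Put $\pi(w)=c_i$ if $w\in V(C_i)$ and $\pi(w)=w$ if $w$ lies in no $C_i$. The trail-skeleton $D_B^{\mathrm{trail}}$ is the directed multigraph rooted at $r$ with vertex set $\pi(V(B))$, having for each trail-directable edge $e$ of $B$ with natural orientation from $u$ to $v$ one directed edge from $\pi(u)$ to $\pi(v)$. $\lambda_B^{\mathrm{trail}}(v,w)$ (resp. $\lambda_B^{\mathrm{path}}(v,w)$) is the maximum number of pairwise edge-disjoint $v$--$w$ trails (resp. paths) in $B$; $\lambda_D(v,w)$ is the maximum number of pairwise edge-disjoint directed $v$--$w$ paths in the directed graph $D$. *)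

theory Defs
  imports "Graph_Theory.Graph_Theory"
begin

section \<open>Bidirected graphs\<close>

datatype sign = Plus | Minus

primrec opp :: "sign \<Rightarrow> sign" where
  "opp Plus = Minus"
| "opp Minus = Plus"

text \<open>
  The value \<open>sgn_of B e u\<close> is the sign of the half-edge \<open>(e, u)\<close>; it is only meaningful (and only
  used) if \<open>u\<close> is an endpoint of the edge \<open>e\<close>.
\<close>

record ('v, 'e) bidirected_graph =
  bverts :: "'v set"
  bedges :: "'e set"
  ends :: "'e \<Rightarrow> 'v set"
  sgn_of :: "'e \<Rightarrow> 'v \<Rightarrow> sign"

locale bidirected_graph =
  fixes B :: "('v, 'e) bidirected_graph"
  assumes finite_bverts: "finite (bverts B)"
    and finite_bedges: "finite (bedges B)"
    and ends_subset: "e \<in> bedges B \<Longrightarrow> ends B e \<subseteq> bverts B"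
    and card_ends: "e \<in> bedges B \<Longrightarrow> card (ends B e) = 2"

locale rooted_bidirected_graph = bidirected_graph B
  for B :: "('v, 'e) bidirected_graph" +
  fixes r :: 'v
  assumes root_in_bverts: "r \<in> bverts B"

section \<open>Oriented edges, trails and paths\<close>

text \<open>The triple \<open>(u, e, v)\<close> is the orientation of the edge \<open>e\<close> with tail \<open>u\<close> and head \<open>v\<close>.\<close>

type_synonym ('v, 'e) oriented_edge = "'v \<times> 'e \<times> 'v"

fun otail :: "('v, 'e) oriented_edge \<Rightarrow> 'v" where
  "otail (u, e, v) = u"

fun oedge :: "('v, 'e) oriented_edge \<Rightarrow> 'e" where
  "oedge (u, e, v) = e"

fun ohead :: "('v, 'e) oriented_edge \<Rightarrow> 'v" where
  "ohead (u, e, v) = v"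

fun oreverse :: "('v, 'e) oriented_edge \<Rightarrow> ('v, 'e) oriented_edge" where
  "oreverse (u, e, v) = (v, e, u)"

definition oriented_edges :: "('v, 'e) bidirected_graph \<Rightarrow> ('v, 'e) oriented_edge set" where
  "oriented_edges B = {(u, e, v). e \<in> bedges B \<and> ends B e = {u, v}}"

text \<open>
  The symmetric digraph whose arcs are all the oriented edges. Its walks are the walks of the
  underlying undirected multigraph.
\<close>

definition symmetric_digraph ::
    "('v, 'e) bidirected_graph \<Rightarrow> ('v, ('v, 'e) oriented_edge) pre_digraph" where
  "symmetric_digraph B =
     \<lparr> verts = bverts B, arcs = oriented_edges B, tail = otail, head = ohead \<rparr>"

text \<open>
  A trail \<open>v\<^sub>0 e\<^sub>1 v\<^sub>1 \<dots> e\<^sub>l v\<^sub>l\<close> is represented by its list of oriented edges, which determines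
  it together with \<open>v\<^sub>0\<close>. The entry \<open>p ! i\<close> is the \<open>(i+1)\<close>-st oriented edge of the trail.
\<close>

definition btrail ::
    "('v, 'e) bidirected_graph \<Rightarrow> 'v \<Rightarrow> ('v, 'e) oriented_edge list \<Rightarrow> 'v \<Rightarrow> bool" where
  "btrail B v p w \<longleftrightarrow>
     pre_digraph.awalk (symmetric_digraph B) v p w \<and>
     distinct (map oedge p) \<and>
     (\<forall>i. Suc i < length p \<longrightarrow>
        sgn_of B (oedge (p ! Suc i)) (ohead (p ! i))
          = opp (sgn_of B (oedge (p ! i)) (ohead (p ! i))))"

definition btrail_verts ::
    "('v, 'e) bidirected_graph \<Rightarrow> 'v \<Rightarrow> ('v, 'e) oriented_edge list \<Rightarrow> 'v list" where
  "btrail_verts B v p = pre_digraph.awalk_verts (symmetric_digraph B) v p"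

definition bpath ::
    "('v, 'e) bidirected_graph \<Rightarrow> 'v \<Rightarrow> ('v, 'e) oriented_edge list \<Rightarrow> 'v \<Rightarrow> bool" where
  "bpath B v p w \<longleftrightarrow> btrail B v p w \<and> distinct (btrail_verts B v p)"

text \<open>\<open>butlast (tl vs)\<close> lists the internal vertices of a trail with vertex sequence \<open>vs\<close>.\<close>

definition root_trail ::
    "('v, 'e) bidirected_graph \<Rightarrow> 'v \<Rightarrow> ('v, 'e) oriented_edge list \<Rightarrow> bool" where
  "root_trail B r p \<longleftrightarrow>
     (\<exists>w. btrail B r p w) \<and> r \<notin> set (butlast (tl (btrail_verts B r p)))"

definition trail_reaches ::
    "('v, 'e) bidirected_graph \<Rightarrow> 'v \<Rightarrow> ('v, 'e) oriented_edge \<Rightarrow> bool" where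
  "trail_reaches B r a \<longleftrightarrow> (\<exists>p. root_trail B r p \<and> p \<noteq> [] \<and> last p = a)"

definition path_reaches ::
    "('v, 'e) bidirected_graph \<Rightarrow> 'v \<Rightarrow> ('v, 'e) oriented_edge \<Rightarrow> bool" where
  "path_reaches B r a \<longleftrightarrow> (\<exists>p w. bpath B r p w \<and> p \<noteq> [] \<and> last p = a)"

definition trail_reachable :: "('v, 'e) bidirected_graph \<Rightarrow> 'v \<Rightarrow> bool" where
  "trail_reachable B r \<longleftrightarrow>
     (\<forall>e\<in>bedges B. \<exists>a\<in>oriented_edges B. oedge a = e \<and> trail_reaches B r a)"

definition path_reachable :: "('v, 'e) bidirected_graph \<Rightarrow> 'v \<Rightarrow> bool" where
  "path_reachable B r \<longleftrightarrow>
     (\<forall>e\<in>bedges B. \<exists>a\<in>oriented_edges B. oedge a = e \<and> path_reaches B r a)"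

section \<open>Trail-undirectable components\<close>

definition trail_undirectable :: "('v, 'e) bidirected_graph \<Rightarrow> 'v \<Rightarrow> 'e \<Rightarrow> bool" where
  "trail_undirectable B r e \<longleftrightarrow>
     (\<exists>a\<in>oriented_edges B. oedge a = e \<and> trail_reaches B r a \<and> trail_reaches B r (oreverse a))"

definition trail_directable :: "('v, 'e) bidirected_graph \<Rightarrow> 'v \<Rightarrow> 'e \<Rightarrow> bool" where
  "trail_directable B r e \<longleftrightarrow>
     (\<exists>!a. a \<in> oriented_edges B \<and> oedge a = e \<and> trail_reaches B r a)"

definition natural_orientation ::
    "('v, 'e) bidirected_graph \<Rightarrow> 'v \<Rightarrow> 'e \<Rightarrow> ('v, 'e) oriented_edge" where
  "natural_orientation B r e =
     (THE a. a \<in> oriented_edges B \<and> oedge a = e \<and> trail_reaches B r a)"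

definition edge_subgraph ::
    "('v, 'e) bidirected_graph \<Rightarrow> 'e set \<Rightarrow> ('v, 'e) bidirected_graph" where
  "edge_subgraph B F = B\<lparr> bverts := (\<Union>e\<in>F. ends B e), bedges := F \<rparr>"

definition trail_undirectable_digraph ::
    "('v, 'e) bidirected_graph \<Rightarrow> 'v \<Rightarrow> ('v, ('v, 'e) oriented_edge) pre_digraph" where
  "trail_undirectable_digraph B r =
     symmetric_digraph (edge_subgraph B {e \<in> bedges B. trail_undirectable B r e})"

text \<open>
  The vertex sets of the trail-undirectable components: since the digraph above is symmetric, its
  strongly connected components are the connected components of the underlying undirected graph.
  Every component has an edge because the subgraph has no isolated vertices.
\<close>

definition trail_undirectable_components ::
    "('v, 'e) bidirected_graph \<Rightarrow> 'v \<Rightarrow> 'v set set" where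
  "trail_undirectable_components B r = pre_digraph.sccs_verts (trail_undirectable_digraph B r)"

definition edge_clean :: "('v, 'e) bidirected_graph \<Rightarrow> 'v \<Rightarrow> bool" where
  "edge_clean B r \<longleftrightarrow> (\<forall>C\<in>trail_undirectable_components B r. r \<notin> C)"

section \<open>The trail-skeleton\<close>

text \<open>
  For a component with vertex set \<open>C\<close> that avoids the root, \<open>component_entry B r C\<close> is the edge
  \<open>f\<close> by which the component is entered. In a trail-reachable graph it exists and is unique.
\<close>

definition component_entry :: "('v, 'e) bidirected_graph \<Rightarrow> 'v \<Rightarrow> 'v set \<Rightarrow> 'e" where
  "component_entry B r C =
     (THE f. f \<in> bedges B \<and> trail_directable B r f \<and> ohead (natural_orientation B r f) \<in> C)"

definition component_root :: "('v, 'e) bidirected_graph \<Rightarrow> 'v \<Rightarrow> 'v set \<Rightarrow> 'v" where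
  "component_root B r C =
     (if r \<in> C then r else ohead (natural_orientation B r (component_entry B r C)))"

definition skeleton_proj :: "('v, 'e) bidirected_graph \<Rightarrow> 'v \<Rightarrow> 'v \<Rightarrow> 'v" where
  "skeleton_proj B r w =
     (if \<exists>C\<in>trail_undirectable_components B r. w \<in> C
      then component_root B r (THE C. C \<in> trail_undirectable_components B r \<and> w \<in> C)
      else w)"

definition trail_skeleton ::
    "('v, 'e) bidirected_graph \<Rightarrow> 'v \<Rightarrow> ('v, 'e) pre_digraph" where
  "trail_skeleton B r =
     \<lparr> verts = skeleton_proj B r ` bverts B,
       arcs = {e \<in> bedges B. trail_directable B r e},
       tail = (\<lambda>e. skeleton_proj B r (otail (natural_orientation B r e))),
       head = (\<lambda>e. skeleton_proj B r (ohead (natural_orientation B r e))) \<rparr>"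

section \<open>Edge-connectivities\<close>

text \<open>
  The maximum number of pairwise edge-disjoint members of \<open>T\<close>, where \<open>E p\<close> is the edge set of
  \<open>p\<close>. The members of a family are distinct; this only matters for the trivial trail, which is
  edge-disjoint from itself, and so occurs for equal endpoints only.
\<close>

definition max_edge_disjoint :: "('p \<Rightarrow> 'e set) \<Rightarrow> 'p set \<Rightarrow> nat" where
  "max_edge_disjoint E T =
     Max {card P | P. P \<subseteq> T \<and> finite P \<and> pairwise (\<lambda>p q. E p \<inter> E q = {}) P}"

definition lambda_trail :: "('v, 'e) bidirected_graph \<Rightarrow> 'v \<Rightarrow> 'v \<Rightarrow> nat" where
  "lambda_trail B v w = max_edge_disjoint (\<lambda>p. oedge ` set p) {p. btrail B v p w}"

definition lambda_path :: "('v, 'e) bidirected_graph \<Rightarrow> 'v \<Rightarrow> 'v \<Rightarrow> nat" where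
  "lambda_path B v w = max_edge_disjoint (\<lambda>p. oedge ` set p) {p. bpath B v p w}"

definition lambda_digraph :: "('v, 'e) pre_digraph \<Rightarrow> 'v \<Rightarrow> 'v \<Rightarrow> nat" where
  "lambda_digraph D v w = max_edge_disjoint set {p. pre_digraph.apath D v p w}"

end

theory Submission
  imports Defs
begin

text \<open>
  By edge-cleanness no trail starting in \<open>r\<close> returns to \<open>r\<close>. As for Edmonds' blossoms,
  call a set \<open>Z\<close> of edges a blossom with base \<open>f\<close>, for an oriented edge \<open>f\<close>, if both orientations of
  every edge of \<open>Z\<close> end a trail that starts with \<open>f\<close> and then runs inside \<open>Z\<close>. If \<open>f\<close> is a naturally
  oriented trail-directable edge, then a trail from \<open>r\<close> can enter \<open>Z\<close> only through \<open>f\<close>, since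
  otherwise it could leave through \<open>f\<close> backwards. Hence blossoms that share a vertex have the same
  base. Each trail-undirectable edge lies in such a blossom, so each trail-undirectable component
  has exactly one entering edge.

  A trail from \<open>r\<close> projects to a walk of the skeleton. Conversely a path of the skeleton lifts by
  filling in, whenever it enters a component, a segment of a trail (or path) ending in the next
  edge of the skeleton path. Assigning to each edge of a component the edge entering that component
  shows that lifts of edge-disjoint paths are edge-disjoint.
\<close>

section \<open>Trails as lists of oriented edges\<close>

lemma opp_opp [simp]: "opp (opp s) = s"
  by (cases s) simp_all

lemma neq_imp_eq_opp: "s \<noteq> t \<Longrightarrow> s = opp t"
  by (cases s; cases t) simp_all

lemma oreverse_simps [simp]:
  "ohead (oreverse a) = otail a" "otail (oreverse a) = ohead a"
  "oedge (oreverse a) = oedge a" "oreverse (oreverse a) = a"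
  by (cases a; simp)+

lemma image_disjointI:
  assumes "\<And>c. c \<in> Y \<Longrightarrow> f c \<notin> f ` X"
  shows "f ` X \<inter> f ` Y = {}"
proof (intro equals0I)
  fix e
  assume e: "e \<in> f ` X \<inter> f ` Y"
  obtain c where "e = f c" "c \<in> Y"
    using IntD2[OF e] by (rule imageE)
  with assms[of c] IntD1[OF e] show False
    by simp
qed

definition link ::
    "('v, 'e) bidirected_graph \<Rightarrow> ('v, 'e) oriented_edge \<Rightarrow> ('v, 'e) oriented_edge \<Rightarrow> bool" where
  "link B a b \<longleftrightarrow>
     ohead a = otail b \<and> sgn_of B (oedge b) (ohead a) = opp (sgn_of B (oedge a) (ohead a))"

lemma link_oreverse: "link B (oreverse b) (oreverse a) \<longleftrightarrow> link B a b"
  by (auto simp: link_def)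

text \<open>A trail without a prescribed start vertex, so that segments and reversals are again of
  this form and gluing is list append.\<close>

definition otrail :: "('v, 'e) bidirected_graph \<Rightarrow> ('v, 'e) oriented_edge list \<Rightarrow> bool" where
  "otrail B p \<longleftrightarrow>
     set p \<subseteq> oriented_edges B \<and> successively (link B) p \<and> distinct (map oedge p)"

definition orev :: "('v, 'e) oriented_edge list \<Rightarrow> ('v, 'e) oriented_edge list" where
  "orev p = rev (map oreverse p)"

lemma orev_simps [simp]:
  "orev [] = []" "orev (a # p) = orev p @ [oreverse a]" "orev (p @ q) = orev q @ orev p"
  "orev (orev p) = p" "oedge ` set (orev p) = oedge ` set p" "orev p = [] \<longleftrightarrow> p = []"
  by (auto simp: orev_def rev_map o_def image_image)

lemma hd_orev: "p \<noteq> [] \<Longrightarrow> hd (orev p) = oreverse (last p)"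
  by (simp add: orev_def hd_rev last_map)

lemma last_orev: "p \<noteq> [] \<Longrightarrow> last (orev p) = oreverse (hd p)"
  by (simp add: orev_def last_rev hd_map)

lemma oriented_edges_oreverse [simp]:
  "oreverse a \<in> oriented_edges B \<longleftrightarrow> a \<in> oriented_edges B"
  by (cases a) (auto simp: oriented_edges_def)

lemma otrail_Nil [simp]: "otrail B []"
  by (simp add: otrail_def)

lemma otrail_append:
  "otrail B (p @ q) \<longleftrightarrow>
     otrail B p \<and> otrail B q \<and> (p \<noteq> [] \<longrightarrow> q \<noteq> [] \<longrightarrow> link B (last p) (hd q)) \<and>
     oedge ` set p \<inter> oedge ` set q = {}"
  by (auto simp: otrail_def successively_append_iff)

lemma otrail_Cons:
  "otrail B (a # q) \<longleftrightarrow>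
     a \<in> oriented_edges B \<and> otrail B q \<and> (q \<noteq> [] \<longrightarrow> link B a (hd q)) \<and>
     oedge a \<notin> oedge ` set q"
  by (auto simp: otrail_def successively_Cons)

lemma otrail_orev [simp]: "otrail B (orev p) \<longleftrightarrow> otrail B p"
proof -
  have *: "otrail B (orev p)" if "otrail B p" for p
    using that
  proof (induction p)
    case (Cons a p)
    then have "oedge a \<notin> oedge ` set (orev p)"
      by (simp add: otrail_Cons del: image_iff)
    with Cons show ?case
      by (auto simp: otrail_append otrail_Cons last_orev link_oreverse)
  qed simp
  from *[of p] *[of "orev p"] show ?thesis
    by auto
qed

lemma otrail_in_oriented_edges: "otrail B p \<Longrightarrow> a \<in> set p \<Longrightarrow> a \<in> oriented_edges B"
  by (auto simp: otrail_def)

definition rtrail ::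
    "('v, 'e) bidirected_graph \<Rightarrow> 'v \<Rightarrow> ('v, 'e) oriented_edge list \<Rightarrow> bool" where
  "rtrail B r p \<longleftrightarrow> otrail B p \<and> (p \<noteq> [] \<longrightarrow> otail (hd p) = r)"

lemma rtrail_prefix: "rtrail B r (p @ q) \<Longrightarrow> rtrail B r p"
  by (auto simp: rtrail_def otrail_append)

lemma rtrail_append:
  "p \<noteq> [] \<Longrightarrow> rtrail B r (p @ q) \<longleftrightarrow> rtrail B r p \<and> otrail B (p @ q)"
  by (auto simp: rtrail_def otrail_append)

context pre_digraph
begin

lemma awalk_snoc:
  "awalk u (p @ [a]) v \<longleftrightarrow> awalk u p (tail G a) \<and> a \<in> arcs G \<and> head G a = v"
proof -
  have "cas u (p @ [a]) v \<longleftrightarrow> cas u p (tail G a) \<and> head G a = v" for u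
    by (induction p arbitrary: u) auto
  then show ?thesis
    by (auto simp: awalk_def)
qed

end

context bidirected_graph
begin

lemma otail_neq_ohead: "a \<in> oriented_edges B \<Longrightarrow> otail a \<noteq> ohead a"
  using card_ends by (cases a) (force simp: oriented_edges_def)

lemma oriented_edge_in_bverts:
  "a \<in> oriented_edges B \<Longrightarrow> otail a \<in> bverts B \<and> ohead a \<in> bverts B \<and> oedge a \<in> bedges B \<and>
    ends B (oedge a) = {otail a, ohead a}"
  using ends_subset by (cases a) (force simp: oriented_edges_def)

lemma oriented_edges_cases:
  "a \<in> oriented_edges B \<Longrightarrow> b \<in> oriented_edges B \<Longrightarrow> oedge a = oedge b \<Longrightarrow>
    b = a \<or> b = oreverse a"
  by (cases a; cases b) (auto simp: oriented_edges_def doubleton_eq_iff)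

lemma obtain_orientation:
  assumes "e \<in> bedges B"
  obtains a where "a \<in> oriented_edges B" "oedge a = e"
proof -
  obtain u v where "ends B e = {u, v}"
    using card_ends[OF assms] by (auto simp: card_2_iff)
  with assms show ?thesis
    by (intro that[of "(u, e, v)"]) (auto simp: oriented_edges_def)
qed

lemma finite_oriented_edges: "finite (oriented_edges B)"
proof (rule finite_subset)
  show "oriented_edges B \<subseteq> bverts B \<times> bedges B \<times> bverts B"
    using ends_subset by (auto simp: oriented_edges_def)
qed (simp add: finite_bverts finite_bedges)

end

section \<open>Trails from the root in list form\<close>

context rooted_bidirected_graph
begin

text \<open>The walk condition gives the chain of heads and tails, the index condition gives the
  signs; together they are \<open>link\<close> between neighbours. The list determines the end
  vertex, which is \<open>r\<close> for the empty list.\<close>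

lemma btrail_iff_rtrail:
  "btrail B r p w \<longleftrightarrow> rtrail B r p \<and> w = (if p = [] then r else ohead (last p))"
proof -
  have cas: "pre_digraph.cas (symmetric_digraph B) v p w \<longleftrightarrow>
      successively (\<lambda>a b. ohead a = otail b) p \<and> (p \<noteq> [] \<longrightarrow> otail (hd p) = v) \<and>
      w = (if p = [] then v else ohead (last p))" for v
  proof (induction p arbitrary: v)
    case Nil
    show ?case
      by (auto simp: pre_digraph.cas.simps)
  next
    case (Cons a p)
    show ?case
      unfolding pre_digraph.cas.simps Cons.IH
      by (cases p) (simp_all add: symmetric_digraph_def eq_commute[of "ohead a"] conj_commute conj_left_commute)
  qed
  have "link B = (\<lambda>a b. ohead a = otail b \<and>
      sgn_of B (oedge b) (ohead a) = opp (sgn_of B (oedge a) (ohead a)))"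
    by (simp add: link_def fun_eq_iff)
  then have succ: "successively (link B) p \<longleftrightarrow> successively (\<lambda>a b. ohead a = otail b) p \<and>
     (\<forall>i. Suc i < length p \<longrightarrow>
        sgn_of B (oedge (p ! Suc i)) (ohead (p ! i))
          = opp (sgn_of B (oedge (p ! i)) (ohead (p ! i))))"
    unfolding successively_conv_nth by (simp only: all_conj_distrib imp_conjR)
  show ?thesis
    unfolding btrail_def rtrail_def otrail_def pre_digraph.awalk_def cas succ
    using root_in_bverts by (simp only: symmetric_digraph_def pre_digraph.select_convs) blast
qed

lemma btrail_verts_eq:
  assumes "rtrail B r p"
  shows "btrail_verts B r p = r # map ohead p"
proof -
  from assms have "btrail B r p (if p = [] then r else ohead (last p))"
    by (simp add: btrail_iff_rtrail)
  then have "pre_digraph.cas (symmetric_digraph B) r p (if p = [] then r else ohead (last p))"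
    by (simp add: btrail_def pre_digraph.awalk_def)
  from pre_digraph.awalk_verts_conv'[OF this] assms show ?thesis
    by (simp add: btrail_verts_def rtrail_def symmetric_digraph_def)
qed

lemma root_trail_iff: "root_trail B r p \<longleftrightarrow> rtrail B r p \<and> r \<notin> ohead ` set (butlast p)"
  by (cases "rtrail B r p")
    (simp_all add: root_trail_def btrail_iff_rtrail btrail_verts_eq flip: map_butlast)

end

section \<open>Blossoms\<close>

text \<open>The edge \<open>a\<close> itself may lie outside \<open>Z\<close>: the notion also
  covers edges leaving \<open>Z\<close>, which is what lets blossoms grow.\<close>

definition accessible ::
    "('v, 'e) bidirected_graph \<Rightarrow> 'e set \<Rightarrow> ('v, 'e) oriented_edge \<Rightarrow> ('v, 'e) oriented_edge \<Rightarrow> bool"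
  where "accessible B Z f a \<longleftrightarrow> (\<exists>q. otrail B (f # q @ [a]) \<and> oedge ` set q \<subseteq> Z)"

text \<open>The empty set is a blossom for every \<open>f\<close> and starts the growth. The edge of
  \<open>f\<close> is never in \<open>Z\<close>, because a trail cannot use it a second
  time.\<close>

definition blossom ::
    "('v, 'e) bidirected_graph \<Rightarrow> ('v, 'e) oriented_edge \<Rightarrow> 'e set \<Rightarrow> bool" where
  "blossom B f Z \<longleftrightarrow> Z \<subseteq> bedges B \<and> (\<forall>a\<in>oriented_edges B. oedge a \<in> Z \<longrightarrow> accessible B Z f a)"

lemma accessible_mono: "accessible B Z f a \<Longrightarrow> Z \<subseteq> Z' \<Longrightarrow> accessible B Z' f a"
  unfolding accessible_def by blast

text \<open>There are only two signs at the vertex \<open>ohead z\<close>. If \<open>a\<close> can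
  follow \<open>z\<close>, it extends a trail ending in \<open>z\<close>; otherwise \<open>a\<close>
  has the sign of \<open>z\<close> there and can replace \<open>oreverse z\<close> at the end of a
  trail ending in \<open>oreverse z\<close>.\<close>

lemma accessible_at:
  assumes bl: "blossom B f Z" and z: "z \<in> oriented_edges B" "oedge z \<in> Z"
    and a: "a \<in> oriented_edges B" "otail a = ohead z" "oedge a \<notin> Z" "oedge a \<noteq> oedge f"
  shows "accessible B Z f a"
proof (cases "link B z a")
  case True
  from bl z obtain q where q: "otrail B (f # q @ [z])" "oedge ` set q \<subseteq> Z"
    by (auto simp: blossom_def accessible_def)
  have "otrail B ((f # q @ [z]) @ [a])"
    unfolding otrail_append[of B "f # q @ [z]"]
    using q z a True by (auto simp: otrail_Cons)
  with q z show ?thesis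
    unfolding accessible_def by (intro exI[of _ "q @ [z]"]) auto
next
  case False
  from bl z have "accessible B Z f (oreverse z)"
    by (simp add: blossom_def)
  then obtain q where q: "otrail B (f # q @ [oreverse z])" "oedge ` set q \<subseteq> Z"
    unfolding accessible_def by blast
  have "sgn_of B (oedge a) (ohead z) = sgn_of B (oedge z) (ohead z)"
    using False a(2) neq_imp_eq_opp by (auto simp: link_def)
  then have same: "link B c (oreverse z) \<longleftrightarrow> link B c a" for c
    using a(2) by (auto simp: link_def)
  have q': "otrail B (f # q)" "link B (last (f # q)) (oreverse z)"
    using q(1) otrail_append[of B "f # q" "[oreverse z]"] by auto
  have "otrail B ((f # q) @ [a])"
    unfolding otrail_append[of B "f # q"]
    using q' q(2) a same by (auto simp: otrail_Cons)
  with q show ?thesis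
    unfolding accessible_def by (intro exI[of _ q]) auto
qed

text \<open>Only the part of the trail behind its last edge in \<open>Z\<close> has to be followed:
  it avoids \<open>Z\<close>, so it can be appended to a trail that runs from \<open>f\<close>
  through \<open>Z\<close> to its first edge.\<close>

lemma accessible_along:
  assumes bl: "blossom B f Z" and s: "otrail B (s @ [a])" and f: "oedge f \<notin> oedge ` set (s @ [a])"
    and start: "oedge (hd (s @ [a])) \<in> Z \<or> accessible B Z f (hd (s @ [a]))"
  shows "accessible B (Z \<union> oedge ` set (s @ [a])) f a"
proof (cases "oedge a \<in> Z")
  case True
  with bl s show ?thesis
    by (auto simp: blossom_def otrail_append otrail_Cons intro: accessible_mono)
next
  case False
  \<comment> \<open>Cut \<open>s\<close> behind its last edge in \<open>Z\<close>, where
    \<open>accessible_at\<close> applies to the next edge. If \<open>s\<close> has no edge in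
    \<open>Z\<close>, keep all of \<open>s\<close> and use \<open>start\<close>.\<close>
  have ex: "\<exists>s1 s2. s = s1 @ s2 \<and> oedge ` set s2 \<inter> Z = {} \<and> accessible B Z f (hd (s2 @ [a]))"
  proof (cases "\<exists>z\<in>set s. oedge z \<in> Z")
    case True
    obtain s1 z s2 where s_eq: "s = s1 @ z # s2" "oedge z \<in> Z" "\<forall>y\<in>set s2. oedge y \<notin> Z"
      using split_list_last_prop[OF True] by blast
    let ?d = "hd (s2 @ [a])"
    have "otrail B (z # s2 @ [a])"
      using s s_eq by (auto simp: otrail_append)
    then have z: "z \<in> oriented_edges B" "link B z ?d" "otrail B (s2 @ [a])"
      by (auto simp: otrail_Cons)
    have d: "?d \<in> set (s2 @ [a])"
      by (intro hd_in_set) simp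
    have "accessible B Z f ?d"
    proof (rule accessible_at[OF bl z(1) s_eq(2)])
      show "?d \<in> oriented_edges B"
        using z(3) d by (rule otrail_in_oriented_edges)
      show "otail ?d = ohead z"
        using z by (simp add: link_def)
      show "oedge ?d \<notin> Z"
        using d False s_eq(3) by auto
      show "oedge ?d \<noteq> oedge f"
      proof -
        have "?d \<in> set (s @ [a])"
          using d s_eq(1) by auto
        then show ?thesis
          using f by (metis imageI)
      qed
    qed
    with s_eq show ?thesis
      by (intro exI[of _ "s1 @ [z]"] exI[of _ s2]) auto
  next
    case False
    with \<open>oedge a \<notin> Z\<close> have "oedge (hd (s @ [a])) \<notin> Z"
      by (cases s) auto
    with False start show ?thesis
      by (intro exI[of _ "[]"] exI[of _ s]) auto
  qed
  then obtain s1 s2 where s_eq: "s = s1 @ s2" and s2: "oedge ` set s2 \<inter> Z = {}"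
    and accessible: "accessible B Z f (hd (s2 @ [a]))"
    by blast
  let ?d = "hd (s2 @ [a])"
  from accessible obtain q where q: "otrail B ((f # q) @ [?d])" "oedge ` set q \<subseteq> Z"
    unfolding accessible_def by auto
  then have q': "otrail B (f # q)" "link B (last (f # q)) ?d"
    unfolding otrail_append[of B "f # q"] by simp_all
  have s2a: "otrail B (s2 @ [a])" "oedge f \<notin> oedge ` set (s2 @ [a])"
    using s f s_eq by (auto simp: otrail_append)
  have "otrail B ((f # q) @ (s2 @ [a]))"
    unfolding otrail_append[of B "f # q"]
    using q' s2a q(2) s2 False by auto
  then show ?thesis
    using q(2) s_eq unfolding accessible_def by (intro exI[of _ "q @ s2"]) auto
qed

text \<open>An ear attached to the blossom at both ends: following \<open>s\<close> makes one
  orientation of each of its edges accessible, following its reversal the other.\<close>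

lemma (in bidirected_graph) blossom_ear:
  assumes bl: "blossom B f Z" and s: "otrail B s" "s \<noteq> []" and f: "oedge f \<notin> oedge ` set s"
    and start: "oedge (hd s) \<in> Z \<or> accessible B Z f (hd s)"
    and finish: "oedge (last s) \<in> Z \<or> accessible B Z f (oreverse (last s))"
  shows "blossom B f (Z \<union> oedge ` set s)"
proof -
  have fwd: "accessible B (Z \<union> oedge ` set s) f a"
    if s: "otrail B s" "oedge f \<notin> oedge ` set s" and start: "oedge (hd s) \<in> Z \<or> accessible B Z f (hd s)"
      and "a \<in> set s" for s a
  proof -
    from \<open>a \<in> set s\<close> obtain s1 s2 where s_eq: "s = (s1 @ [a]) @ s2"
      by (auto dest: split_list)
    then have "hd s = hd (s1 @ [a])"
      by (cases s1) auto
    moreover have "otrail B (s1 @ [a])" "oedge f \<notin> oedge ` set (s1 @ [a])"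
      using s s_eq otrail_append[of B "s1 @ [a]" s2] by auto
    ultimately have "accessible B (Z \<union> oedge ` set (s1 @ [a])) f a"
      using accessible_along[OF bl] start by auto
    then show ?thesis
      by (rule accessible_mono) (auto simp: s_eq)
  qed
  have "accessible B (Z \<union> oedge ` set s) f a"
    if a: "a \<in> oriented_edges B" "oedge a \<in> Z \<union> oedge ` set s" for a
  proof (cases "oedge a \<in> Z")
    case True
    with bl a(1) show ?thesis
      by (auto simp: blossom_def intro: accessible_mono)
  next
    case False
    with a(2) obtain b where b: "b \<in> set s" "oedge b = oedge a"
      by auto
    with s(1) have "b \<in> oriented_edges B"
      by (auto intro: otrail_in_oriented_edges)
    then have "a = b \<or> a = oreverse b"
      using oriented_edges_cases a(1) b(2) by blast
    then show ?thesis
    proof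
      assume "a = b"
      with fwd[OF s(1) f start] b(1) show ?thesis
        by simp
    next
      assume "a = oreverse b"
      with b(1) have "a \<in> set (orev s)"
        by (simp add: orev_def)
      moreover have "oedge (hd (orev s)) \<in> Z \<or> accessible B Z f (hd (orev s))"
        using finish s(2) by (simp add: hd_orev)
      ultimately show ?thesis
        using fwd[of "orev s" a] s(1) f by (simp del: image_iff)
    qed
  qed
  moreover have "oedge ` set s \<subseteq> bedges B"
    using s(1) oriented_edge_in_bverts by (auto simp: otrail_def)
  ultimately show ?thesis
    using bl by (auto simp: blossom_def)
qed

section \<open>Edges reached from the root\<close>

definition reached ::
    "('v, 'e) bidirected_graph \<Rightarrow> 'v \<Rightarrow> ('v, 'e) oriented_edge \<Rightarrow> bool" where
  "reached B r a \<longleftrightarrow> (\<exists>p. rtrail B r (p @ [a]))"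

definition natural ::
    "('v, 'e) bidirected_graph \<Rightarrow> 'v \<Rightarrow> ('v, 'e) oriented_edge \<Rightarrow> bool" where
  "natural B r a \<longleftrightarrow> a \<in> oriented_edges B \<and> reached B r a \<and> \<not> reached B r (oreverse a)"

definition undir ::
    "('v, 'e) bidirected_graph \<Rightarrow> 'v \<Rightarrow> ('v, 'e) oriented_edge \<Rightarrow> bool" where
  "undir B r a \<longleftrightarrow> a \<in> oriented_edges B \<and> reached B r a \<and> reached B r (oreverse a)"

lemma reached_if_in_rtrail: "rtrail B r p \<Longrightarrow> a \<in> set p \<Longrightarrow> reached B r a"
proof -
  assume p: "rtrail B r p" "a \<in> set p"
  then obtain p1 p2 where "p = (p1 @ [a]) @ p2"
    by (auto dest: split_list)
  with p show ?thesis
    unfolding reached_def by (metis rtrail_prefix)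
qed

lemma undir_oreverse [simp]: "undir B r (oreverse a) \<longleftrightarrow> undir B r a"
  by (auto simp: undir_def)

lemma not_natural_if_undir: "undir B r a \<Longrightarrow> \<not> natural B r a \<and> \<not> natural B r (oreverse a)"
  by (auto simp: undir_def natural_def)

text \<open>The form in which edge-cleanness enters the theory of blossoms;
  \<open>edge_clean_no_return\<close> supplies it.\<close>

locale no_return_graph = rooted_bidirected_graph B r
  for B :: "('v, 'e) bidirected_graph" and r :: 'v +
  assumes no_return: "rtrail B r p \<Longrightarrow> a \<in> set p \<Longrightarrow> ohead a \<noteq> r"
begin

lemma natural_unique:
  "natural B r a \<Longrightarrow> natural B r b \<Longrightarrow> oedge a = oedge b \<Longrightarrow> a = b"
  using oriented_edges_cases by (metis natural_def)

lemma undir_oedge_cong: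
  "undir B r a \<Longrightarrow> b \<in> oriented_edges B \<Longrightarrow> oedge b = oedge a \<Longrightarrow> undir B r b"
  using oriented_edges_cases by (metis undir_def undir_oreverse)

lemma natural_or_undir: "reached B r a \<Longrightarrow> natural B r a \<or> undir B r a"
  by (auto simp: natural_def undir_def reached_def rtrail_def otrail_append otrail_Cons)

text \<open>A trail traversing the edge backwards would have a prefix reaching
  \<open>oreverse f\<close>.\<close>

lemma natural_in_rtrail:
  assumes "natural B r f" "rtrail B r p" "oedge f \<in> oedge ` set p"
  shows "f \<in> set p"
proof -
  from assms(3) obtain a where a: "a \<in> set p" "oedge a = oedge f"
    by auto
  have "a \<in> oriented_edges B"
    using assms(2) a(1) otrail_in_oriented_edges unfolding rtrail_def by blast
  then have "a = f \<or> a = oreverse f"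
    using oriented_edges_cases[of f a] assms(1) a(2) by (simp add: natural_def)
  moreover have "reached B r a"
    using assms(2) a(1) by (rule reached_if_in_rtrail)
  ultimately show ?thesis
    using a(1) assms(1) by (auto simp only: natural_def)
qed

section \<open>Blossoms with a naturally oriented base\<close>

definition bl_verts :: "'e set \<Rightarrow> 'v set" where
  "bl_verts Z = (\<Union>e\<in>Z. ends B e)"

lemma bl_verts_iff:
  assumes "Z \<subseteq> bedges B"
  shows "v \<in> bl_verts Z \<longleftrightarrow> (\<exists>z\<in>oriented_edges B. oedge z \<in> Z \<and> ohead z = v)"
proof
  assume "v \<in> bl_verts Z"
  then obtain e where e: "e \<in> Z" "v \<in> ends B e"
    by (auto simp: bl_verts_def)
  with assms obtain a where a: "a \<in> oriented_edges B" "oedge a = e"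
    using obtain_orientation by blast
  then have "ohead a = v \<or> ohead (oreverse a) = v"
    using e oriented_edge_in_bverts by fastforce
  with a e show "\<exists>z\<in>oriented_edges B. oedge z \<in> Z \<and> ohead z = v"
    by (metis oreverse_simps(3) oriented_edges_oreverse)
next
  assume "\<exists>z\<in>oriented_edges B. oedge z \<in> Z \<and> ohead z = v"
  then obtain z where z: "z \<in> oriented_edges B" "oedge z \<in> Z" "ohead z = v"
    by blast
  then have "v \<in> ends B (oedge z)"
    using oriented_edge_in_bverts by blast
  with z(2) show "v \<in> bl_verts Z"
    unfolding bl_verts_def by blast
qed

lemma bl_vertsI:
  "Z \<subseteq> bedges B \<Longrightarrow> a \<in> oriented_edges B \<Longrightarrow> oedge a \<in> Z \<Longrightarrow> ohead a \<in> bl_verts Z \<and> otail a \<in> bl_verts Z"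
  using bl_verts_iff by (metis oreverse_simps(1,3) oriented_edges_oreverse)

text \<open>A trail from \<open>f\<close> through \<open>Z\<close> to \<open>r\<close>, read
  backwards, would be a trail from \<open>r\<close> ending in \<open>oreverse f\<close>.\<close>

lemma root_notin_blossom:
  assumes bl: "blossom B f Z" and f: "natural B r f"
  shows "r \<notin> bl_verts Z"
proof
  assume "r \<in> bl_verts Z"
  with bl obtain z where z: "z \<in> oriented_edges B" "oedge z \<in> Z" "ohead z = r"
    using bl_verts_iff by (auto simp: blossom_def)
  with bl obtain q where "otrail B (f # q @ [z])"
    by (auto simp: blossom_def accessible_def)
  then have "otrail B (orev (f # q @ [z]))"
    by (simp only: otrail_orev)
  with z(3) have "rtrail B r ((oreverse z # orev q) @ [oreverse f])"
    by (simp add: rtrail_def)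
  with f show False
    unfolding natural_def reached_def by blast
qed

text \<open>Here \<open>d\<close> is the first edge to arrive at a vertex of \<open>Z\<close>. If it
  were not \<open>f\<close>, then \<open>oreverse d\<close> would leave \<open>Z\<close> at that
  vertex and be accessible; the reversed witness, appended to \<open>p\<close>, would end in
  \<open>oreverse f\<close>.\<close>

lemma blossom_entry:
  assumes bl: "blossom B f Z" and f: "natural B r f"
    and p: "rtrail B r (p @ [d])" "ohead d \<in> bl_verts Z" "\<forall>b\<in>set p. ohead b \<notin> bl_verts Z"
    and fz: "ohead f \<in> bl_verts Z"
  shows "d = f"
proof (rule ccontr)
  assume "d \<noteq> f"
  have Z: "Z \<subseteq> bedges B"
    using bl by (simp add: blossom_def)
  have d: "d \<in> oriented_edges B" "otrail B (p @ [d])"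
    using p(1) by (auto simp: rtrail_def otrail_append otrail_Cons)
  have f_nin: "f \<notin> set (p @ [d])"
    using p(3) fz \<open>d \<noteq> f\<close> by auto
  then have f_nin: "oedge f \<notin> oedge ` set (p @ [d])"
    using natural_in_rtrail[OF f p(1)] by blast
  \<comment> \<open>An edge of \<open>Z\<close> has both ends in \<open>bl_verts Z\<close>. As
    \<open>d\<close> starts outside, no edge of \<open>p @ [d]\<close> is in
    \<open>Z\<close>.\<close>
  have tl_d: "otail d \<notin> bl_verts Z"
  proof (cases p rule: rev_cases)
    case Nil
    then show ?thesis
      using p(1) root_notin_blossom[OF bl f] by (simp add: rtrail_def)
  next
    case (snoc p' b)
    then have "otail d = ohead b"
      using d(2) otrail_append[of B p "[d]"] by (simp add: link_def)
    with snoc p(3) show ?thesis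
      by simp
  qed
  have nin: "oedge b \<notin> Z" if "b \<in> set (p @ [d])" for b
  proof
    assume "oedge b \<in> Z"
    moreover have "b \<in> oriented_edges B"
      using that d(2) by (rule otrail_in_oriented_edges[rotated])
    ultimately have "ohead b \<in> bl_verts Z" "otail b \<in> bl_verts Z"
      using bl_vertsI[OF Z] by blast+
    with that p(3) tl_d show False
      by auto
  qed
  obtain z where z: "z \<in> oriented_edges B" "oedge z \<in> Z" "ohead z = ohead d"
    using p(2) bl_verts_iff[OF Z] by auto
  have "accessible B Z f (oreverse d)"
    using accessible_at[OF bl z(1,2), of "oreverse d"] d z(3) nin f_nin by auto
  then obtain q where q: "otrail B (f # q @ [oreverse d])" "oedge ` set q \<subseteq> Z"
    unfolding accessible_def by blast
  then have "otrail B (orev (f # q @ [oreverse d]))"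
    by (simp only: otrail_orev)
  then have return: "otrail B (d # orev q @ [oreverse f])"
    by simp
  have "oedge ` set (d # orev q @ [oreverse f]) \<subseteq> {oedge d, oedge f} \<union> Z"
    using q(2) by auto
  moreover have "oedge ` set p \<inter> ({oedge d, oedge f} \<union> Z) = {}"
    using d(2) f_nin nin otrail_append[of B p "[d]"] by auto
  ultimately have "oedge ` set p \<inter> oedge ` set (d # orev q @ [oreverse f]) = {}"
    unfolding disjoint_iff by (meson subsetD)
  then have "otrail B (p @ d # orev q @ [oreverse f])"
    using return d(2) otrail_append[of B p "[d]"] unfolding otrail_append[of B p] by simp
  then have "rtrail B r ((p @ d # orev q) @ [oreverse f])"
    using p(1) by (cases p) (simp_all add: rtrail_def)
  with f show False
    unfolding natural_def reached_def by blast
qed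

text \<open>The edge that follows \<open>f\<close> on a witness lies in \<open>Z\<close> and starts
  at \<open>ohead f\<close>.\<close>

lemma blossom_base_in:
  assumes bl: "blossom B f Z" and Z: "Z \<noteq> {}"
  shows "ohead f \<in> bl_verts Z"
proof -
  from bl have ZB: "Z \<subseteq> bedges B"
    by (simp add: blossom_def)
  from Z obtain e where "e \<in> Z"
    by blast
  with ZB obtain z where z: "z \<in> oriented_edges B" "oedge z \<in> Z"
    using obtain_orientation by blast
  with bl obtain q where q: "otrail B (f # q @ [z])" "oedge ` set q \<subseteq> Z"
    unfolding blossom_def accessible_def by blast
  let ?d = "hd (q @ [z])"
  have "?d \<in> set (q @ [z])"
    by (rule hd_in_set) simp
  then have "oedge ?d \<in> oedge ` set (q @ [z])"
    by (rule imageI)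
  then have "oedge ?d \<in> Z"
    using q(2) z(2) by auto
  moreover have "?d \<in> oriented_edges B"
    using q(1) \<open>?d \<in> set (q @ [z])\<close> otrail_in_oriented_edges by (metis otrail_Cons)
  moreover have "ohead f = otail ?d"
    using q(1) by (simp add: otrail_Cons link_def)
  ultimately show ?thesis
    using bl_vertsI[OF ZB] by simp
qed

lemma blossom_entry_in:
  assumes bl: "blossom B f Z" "Z \<noteq> {}" "natural B r f"
    and p: "rtrail B r p" "a \<in> set p" "ohead a \<in> bl_verts Z"
  shows "\<exists>p1 p2. p = p1 @ f # p2 \<and> (\<forall>b\<in>set p1. ohead b \<notin> bl_verts Z)"
proof -
  from p obtain p1 d p2 where p_eq: "p = p1 @ d # p2" "ohead d \<in> bl_verts Z"
      "\<forall>b\<in>set p1. ohead b \<notin> bl_verts Z"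
    using split_list_first_prop[of p "\<lambda>a. ohead a \<in> bl_verts Z"] by blast
  then have "rtrail B r (p1 @ [d])"
    using p(1) rtrail_prefix[of B r "p1 @ [d]" p2] by simp
  then have "d = f"
    using blossom_entry bl blossom_base_in p_eq by blast
  with p_eq show ?thesis
    by blast
qed

lemma blossom_entry_mem:
  assumes "blossom B f Z" "Z \<noteq> {}" "natural B r f"
    and "rtrail B r p" "a \<in> set p" "ohead a \<in> bl_verts Z"
  shows "f \<in> set p"
  using blossom_entry_in[OF assms] by auto

text \<open>The first entry into \<open>Z\<close> is through \<open>f\<close>, and \<open>f\<close>
  occurs only once, at the end.\<close>

lemma blossom_entry_last:
  assumes bl: "blossom B f Z" "Z \<noteq> {}" "natural B r f" and p: "rtrail B r (p @ [f])"
  shows "\<forall>b\<in>set p. ohead b \<notin> bl_verts Z"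
proof -
  from blossom_entry_in[OF bl p, of f] blossom_base_in[OF bl(1,2)]
  obtain p1 p2 where eq: "p @ [f] = p1 @ f # p2" "\<forall>b\<in>set p1. ohead b \<notin> bl_verts Z"
    by auto
  from p have "f \<notin> set p"
    by (auto simp: rtrail_def otrail_append)
  with eq(1) have "p = p1"
    by (metis append_Cons_eq_iff append_Nil2 empty_set equals0D)
  with eq(2) show ?thesis
    by simp
qed

lemma blossom_entry_last_edges:
  assumes bl: "blossom B f Z" "natural B r f" and p: "rtrail B r (p @ [f])" and b: "b \<in> set p"
  shows "oedge b \<notin> Z"
proof
  assume bZ: "oedge b \<in> Z"
  then have "Z \<noteq> {}" "Z \<subseteq> bedges B"
    using bl(1) by (auto simp: blossom_def)
  moreover have "b \<in> oriented_edges B"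
    using p b unfolding rtrail_def otrail_append[of B p] by (meson otrail_in_oriented_edges)
  ultimately show False
    using bl_vertsI[of Z b] blossom_entry_last[OF bl(1) _ bl(2) p] b bZ by blast
qed

text \<open>A trail to \<open>f\<close> has not yet used an edge of \<open>Z\<close>, so nothing
  obstructs its continuation inside \<open>Z\<close>. Only \<open>a\<close> may lie outside
  \<open>Z\<close>, hence the separate assumption on it.\<close>

lemma rtrail_into_blossom:
  assumes bl: "blossom B f Z" "Z \<noteq> {}" "natural B r f" and p: "rtrail B r (p @ [f])"
    and q: "otrail B (f # q @ [a])" "oedge ` set q \<subseteq> Z"
    and a: "oedge a \<notin> oedge ` set p"
  shows "rtrail B r (p @ f # q @ [a])"
proof -
  have otp: "otrail B (p @ [f])"
    using p by (simp add: rtrail_def)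
  have nin: "oedge b \<notin> Z" if "b \<in> set p" for b
    using blossom_entry_last_edges[OF bl(1,3) p that] .
  have "oedge ` set p \<inter> oedge ` set (f # q @ [a]) = {}"
  proof -
    have "oedge ` set (f # q @ [a]) \<subseteq> {oedge f, oedge a} \<union> Z"
      using q(2) by auto
    moreover have "oedge ` set p \<inter> ({oedge f, oedge a} \<union> Z) = {}"
      using otp a nin otrail_append[of B p "[f]"] by auto
    ultimately show ?thesis
      unfolding disjoint_iff by (meson subsetD)
  qed
  then have "otrail B (p @ f # q @ [a])"
    using otp q(1) unfolding otrail_append[of B p] by simp
  then show ?thesis
    using p by (cases p) (simp_all add: rtrail_def)
qed

lemma reached_natural: "natural B r f \<Longrightarrow> \<exists>p. rtrail B r (p @ [f])"
  by (simp add: natural_def reached_def)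

text \<open>A trail to \<open>f\<close> can be continued inside \<open>Z\<close> to either
  orientation of an edge of \<open>Z\<close>.\<close>

lemma blossom_undir:
  assumes bl: "blossom B f Z" "natural B r f" and a: "a \<in> oriented_edges B" "oedge a \<in> Z"
  shows "undir B r a"
proof -
  obtain p where p: "rtrail B r (p @ [f])"
    using bl(2) reached_natural by blast
  have Z: "Z \<noteq> {}" "Z \<subseteq> bedges B"
    using a bl(1) by (auto simp: blossom_def)
  have "reached B r b" if b: "b \<in> oriented_edges B" "oedge b \<in> Z" for b
  proof -
    from bl(1) b obtain q where q: "otrail B (f # q @ [b])" "oedge ` set q \<subseteq> Z"
      unfolding blossom_def accessible_def by blast
    have "oedge b \<notin> oedge ` set p"
      using blossom_entry_last_edges[OF bl p] b(2) by auto
    from rtrail_into_blossom[OF bl(1) Z(1) bl(2) p q this]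
    have "rtrail B r ((p @ f # q) @ [b])"
      by simp
    then show ?thesis
      unfolding reached_def by blast
  qed
  from this[of a] this[of "oreverse a"] a show ?thesis
    by (simp add: undir_def)
qed

text \<open>Through a second such edge \<open>g\<close> the blossom could be left backwards: a trail
  to \<open>f\<close> cannot contain \<open>g\<close>, whose head is a vertex of \<open>Z\<close>,
  and it continues through \<open>Z\<close> to \<open>oreverse g\<close>.\<close>

lemma blossom_base_unique:
  assumes bl: "blossom B f Z" "Z \<noteq> {}" "natural B r f"
    and g: "natural B r g" "ohead g \<in> bl_verts Z"
  shows "g = f"
proof (rule ccontr)
  assume "g \<noteq> f"
  then have neq: "oedge g \<noteq> oedge f"
    using natural_unique bl(3) g(1) by blast
  have g_or: "g \<in> oriented_edges B"
    using g(1) by (simp add: natural_def)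
  have g_nin: "oedge g \<notin> Z"
    using blossom_undir[OF bl(1,3) g_or] not_natural_if_undir[of B r g] g(1) by blast
  obtain z where z: "z \<in> oriented_edges B" "oedge z \<in> Z" "ohead z = ohead g"
    using g(2) bl(1) bl_verts_iff by (auto simp only: blossom_def)
  have "accessible B Z f (oreverse g)"
    using accessible_at[OF bl(1) z(1,2), of "oreverse g"] g_or z(3) g_nin neq by simp
  then obtain q where q: "otrail B (f # q @ [oreverse g])" "oedge ` set q \<subseteq> Z"
    unfolding accessible_def by blast
  obtain p where p: "rtrail B r (p @ [f])"
    using bl(3) reached_natural by blast
  have "oedge g \<notin> oedge ` set p"
    using natural_in_rtrail[OF g(1) rtrail_prefix[OF p]] blossom_entry_last[OF bl p] g(2) by blast
  then have "rtrail B r ((p @ f # q) @ [oreverse g])"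
    using rtrail_into_blossom[OF bl p q] by simp
  with g(1) show False
    unfolding natural_def reached_def by blast
qed

text \<open>Suppose the bases differ. A trail through \<open>f'\<close> and \<open>Z'\<close> to the
  common vertex \<open>w\<close> must contain \<open>f\<close>, which is not an edge of
  \<open>Z'\<close> and therefore precedes \<open>f'\<close>. Stopping at \<open>f\<close> and
  continuing inside \<open>Z\<close> to \<open>w\<close> gives a trail without \<open>f'\<close>,
  against the entry property of \<open>Z'\<close>.\<close>

lemma blossom_base_eq:
  assumes bl: "blossom B f Z" "natural B r f" and bl': "blossom B f' Z'" "natural B r f'"
    and w: "w \<in> bl_verts Z" "w \<in> bl_verts Z'"
  shows "f' = f"
proof (rule ccontr)
  assume "f' \<noteq> f"
  have Z: "Z \<noteq> {}" "Z \<subseteq> bedges B" and Z': "Z' \<noteq> {}" "Z' \<subseteq> bedges B"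
    using w bl bl' by (auto simp: bl_verts_def blossom_def)
  obtain p' where p': "rtrail B r (p' @ [f'])"
    using bl'(2) reached_natural by blast
  obtain z' where z': "z' \<in> oriented_edges B" "oedge z' \<in> Z'" "ohead z' = w"
    using w(2) bl_verts_iff[OF Z'(2)] by blast
  have z'_in: "ohead z' \<in> bl_verts Z"
    using w(1) z'(3) by simp
  obtain q' where q': "otrail B (f' # q' @ [z'])" "oedge ` set q' \<subseteq> Z'"
    using bl'(1) z' unfolding blossom_def accessible_def by blast
  have avoid: "oedge b \<notin> Z'" if "b \<in> set p'" for b
    using blossom_entry_last_edges[OF bl' p' that] .
  then have "oedge z' \<notin> oedge ` set p'"
    using z'(2) by (metis imageE)
  then have "rtrail B r (p' @ f' # q' @ [z'])"
    by (rule rtrail_into_blossom[OF bl'(1) Z'(1) bl'(2) p' q'])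
  moreover have "z' \<in> set (p' @ f' # q' @ [z'])"
    by simp
  ultimately have "f \<in> set (p' @ f' # q' @ [z'])"
    using blossom_entry_mem[OF bl(1) Z(1) bl(2) _ _ z'_in] by blast
  moreover have "f \<notin> set (q' @ [z'])"
    using blossom_undir[OF bl', of f] q'(2) z'(2) not_natural_if_undir[of B r f] bl(2)
    by (auto simp: natural_def)
  ultimately have "f \<in> set p'"
    using \<open>f' \<noteq> f\<close> by simp
  then obtain p1 p2 where "p' = p1 @ f # p2"
    by (blast dest: split_list)
  then have p1: "rtrail B r (p1 @ [f])" "f' \<notin> set (p1 @ [f])"
    using p' rtrail_prefix[of B r "p1 @ [f]" "p2 @ [f']"]
    by (auto simp: rtrail_def otrail_append otrail_Cons)
  obtain z where z: "z \<in> oriented_edges B" "oedge z \<in> Z" "ohead z = w"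
    using w(1) bl_verts_iff[OF Z(2)] by blast
  obtain q where q: "otrail B (f # q @ [z])" "oedge ` set q \<subseteq> Z"
    using bl(1) z unfolding blossom_def accessible_def by blast
  have avoid: "oedge b \<notin> Z" if "b \<in> set p1" for b
    using blossom_entry_last_edges[OF bl p1(1) that] .
  then have "oedge z \<notin> oedge ` set p1"
    using z(2) by (metis imageE)
  then have "rtrail B r (p1 @ f # q @ [z])"
    by (rule rtrail_into_blossom[OF bl(1) Z(1) bl(2) p1(1) q])
  then have "f' \<in> set (p1 @ f # q @ [z])"
    using blossom_entry_mem[OF bl'(1) Z'(1) bl'(2), of "p1 @ f # q @ [z]" z] w(2) z(3) by simp
  moreover have "f' \<notin> set (q @ [z])"
    using blossom_undir[OF bl, of f'] q(2) z(2) not_natural_if_undir[of B r f'] bl'(2)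
    by (auto simp: natural_def)
  ultimately show False
    using p1(2) by simp
qed

text \<open>
  Follow a trail to \<open>h\<close> and return along a trail to the reversed \<open>h\<close> up to the last edge that the
  two have in common. That edge is either itself the base of a blossom formed by this closed
  detour, or is reached by a shorter trail, and then the detour is an ear of its blossom.
\<close>

lemma undir_in_blossom_aux:
  assumes "rtrail B r (p @ [h])" "undir B r h"
  shows "\<exists>f Z. natural B r f \<and> blossom B f Z \<and> oedge h \<in> Z"
  using assms
proof (induction "length p" arbitrary: p h rule: less_induct)
  case (less p h)
  have h: "h \<in> oriented_edges B" "otrail B (p @ [h])" "oedge h \<notin> oedge ` set p"
    using less.prems by (auto simp: rtrail_def undir_def otrail_append)
  obtain q where q: "rtrail B r (q @ [oreverse h])"
    using less.prems(2) by (auto simp: undir_def reached_def)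
  then have q': "otrail B (q @ [oreverse h])" "oedge h \<notin> oedge ` set q"
    by (auto simp: rtrail_def otrail_append)
  have hback: "otrail B (h # orev q)"
    using q'(1) otrail_orev[of B "q @ [oreverse h]"] by simp
  obtain q1 b q2 where q_eq: "q = q1 @ b # q2" and b: "oedge b \<in> oedge ` set p"
    and q2: "\<forall>c\<in>set q2. oedge c \<notin> oedge ` set p"
  proof -
    \<comment> \<open>Without a common edge, \<open>p\<close>, \<open>h\<close> and the reversal of
      \<open>q\<close> would form a trail that returns to \<open>r\<close>.\<close>
    have "\<exists>b\<in>set q. oedge b \<in> oedge ` set p"
    proof (rule ccontr)
      assume none: "\<not> ?thesis"
      have disj: "oedge ` set p \<inter> oedge ` set (h # orev q) = {}"
      proof -
        have "oedge ` set p \<inter> oedge ` set (h # q) = {}"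
          using none h(3) by (intro image_disjointI) auto
        then show ?thesis
          by simp
      qed
      have ot: "otrail B (p @ h # orev q)"
        unfolding otrail_append[of B p] using h(2) hback disj otrail_append[of B p "[h]"] by simp
      then have "rtrail B r (p @ h # orev q)"
        using less.prems(1) by (cases p) (simp_all add: rtrail_def)
      moreover have "last (p @ h # orev q) \<in> set (p @ h # orev q)"
        by (rule last_in_set) simp
      moreover have "ohead (last (p @ h # orev q)) = r"
        using q by (cases q) (simp_all add: rtrail_def)
      ultimately show False
        using no_return by blast
    qed
    from split_list_last_prop[OF this] that show ?thesis
      by blast
  qed
  from b obtain a where "a \<in> set p" and ab: "oedge a = oedge b"
    by auto
  then obtain p1 p2 where p_eq: "p = p1 @ a # p2"
    by (blast dest: split_list)
  \<comment> \<open>The detour: from the head of \<open>a\<close> on to \<open>h\<close>, then back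
    along the reversal of \<open>q2\<close> to the head of \<open>b\<close>.\<close>
  define s where "s = p2 @ h # orev q2"
  have "oedge ` set p2 \<inter> oedge ` set (h # q2) = {}"
    using h(3) q2 p_eq by (intro image_disjointI) auto
  then have s_disj: "oedge ` set p2 \<inter> oedge ` set (h # orev q2) = {}"
    by simp
  have "otrail B (a # p2 @ [h])"
    using h(2) p_eq otrail_append[of B p1 "a # p2 @ [h]"] by simp
  then have a_s: "a \<in> oriented_edges B" "link B a (hd (p2 @ [h]))" "otrail B (p2 @ [h])"
      "oedge a \<notin> oedge ` set (p2 @ [h])"
    unfolding otrail_Cons by simp_all
  have "otrail B (b # q2 @ [oreverse h])"
    using q'(1) q_eq otrail_append[of B q1 "b # q2 @ [oreverse h]"] by simp
  then have b_s: "b \<in> oriented_edges B" "link B b (hd (q2 @ [oreverse h]))"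
      "otrail B (q2 @ [oreverse h])" "oedge b \<notin> oedge ` set (q2 @ [oreverse h])"
    unfolding otrail_Cons by simp_all
  have "otrail B (h # orev q2)"
    using b_s(3) otrail_orev[of B "q2 @ [oreverse h]"] by simp
  then have s: "otrail B s"
    unfolding s_def otrail_append[of B p2] using s_disj a_s(3) otrail_append[of B p2 "[h]"] by simp
  have link_s: "link B a (hd s)" "link B b (oreverse (last s))"
  proof -
    have "hd s = hd (p2 @ [h])"
      by (cases p2) (simp_all add: s_def)
    moreover have "oreverse (last s) = hd (q2 @ [oreverse h])"
      by (cases q2) (simp_all add: s_def last_orev)
    ultimately show "link B a (hd s)" "link B b (oreverse (last s))"
      using a_s(2) b_s(2) by simp_all
  qed
  have hd_in: "hd s \<in> set s" "last s \<in> set s"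
    by (rule hd_in_set last_in_set; simp add: s_def)+
  have s_or: "hd s \<in> oriented_edges B" "last s \<in> oriented_edges B"
    using hd_in s otrail_in_oriented_edges by blast+
  have ab_nin: "oedge a \<notin> oedge ` set s"
    using a_s(4) b_s(4) ab by (simp add: s_def image_Un)
  have ends_neq: "oedge c \<noteq> oedge (hd s)" "oedge c \<noteq> oedge (last s)"
    if "oedge c \<notin> oedge ` set s" for c
    using that hd_in by auto
  have ra: "rtrail B r (p1 @ [a])"
    using less.prems(1) p_eq rtrail_prefix[of B r "p1 @ [a]" "p2 @ [h]"] by simp
  have rb: "rtrail B r (q1 @ [b])"
    using q q_eq rtrail_prefix[of B r "q1 @ [b]" "q2 @ [oreverse h]"] by simp
  have reach: "reached B r a" "reached B r b"
    using ra rb by (auto simp: reached_def)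
  have "\<exists>f Z. natural B r f \<and> blossom B f Z \<and> oedge f \<notin> oedge ` set s \<and>
      (oedge (hd s) \<in> Z \<or> accessible B Z f (hd s)) \<and>
      (oedge (last s) \<in> Z \<or> accessible B Z f (oreverse (last s)))"
  proof (cases "natural B r a")
    case True
    \<comment> \<open>Both trails traverse the common edge in its natural direction, so the detour
      starts and ends at its head and is an ear of the empty blossom with base
      \<open>a\<close>.\<close>
    have "b = a \<or> b = oreverse a"
      using oriented_edges_cases[OF a_s(1) b_s(1) ab] .
    with True reach(2) have "b = a"
      by (auto simp: natural_def)
    have "otrail B [a, hd s]"
      using a_s(1) link_s(1) s_or(1) ends_neq[OF ab_nin] by (simp add: otrail_Cons)
    then have "accessible B {} a (hd s)"
      unfolding accessible_def by (intro exI[of _ "[]"]) simp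
    moreover have "otrail B [a, oreverse (last s)]"
      using a_s(1) link_s(2) s_or(2) ends_neq[OF ab_nin] \<open>b = a\<close> by (simp add: otrail_Cons)
    then have "accessible B {} a (oreverse (last s))"
      unfolding accessible_def by (intro exI[of _ "[]"]) simp
    moreover have "blossom B a {}"
      by (simp add: blossom_def)
    ultimately show ?thesis
      using True ab_nin by blast
  next
    case False
    with reach(1) have und: "undir B r a"
      using natural_or_undir by blast
    \<comment> \<open>The trail to \<open>a\<close> is shorter. Both ends of \<open>s\<close> are
      ends of the common edge, which lies in \<open>Z\<close>, so \<open>accessible_at\<close>
      applies to each of them even if \<open>a\<close> and \<open>b\<close> are opposite
      orientations.\<close>
    obtain f Z where f: "natural B r f" and bl: "blossom B f Z" and aZ: "oedge a \<in> Z"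
      using less.hyps[OF _ ra und] p_eq by auto
    have ZB: "Z \<subseteq> bedges B"
      using bl by (simp add: blossom_def)
    have "ohead a \<in> bl_verts Z"
      using bl_vertsI[OF ZB a_s(1) aZ] by blast
    then have "f \<in> set (p1 @ [a])"
      using blossom_entry_mem[OF bl _ f ra, of a] aZ by auto
    moreover have "f \<noteq> a"
      using f not_natural_if_undir[OF und] by blast
    ultimately have f_in: "f \<in> set p1"
      by simp
    have fp: "oedge f \<in> oedge ` set p"
      using f_in p_eq by simp
    \<comment> \<open>On the trail to \<open>h\<close>, \<open>f\<close> precedes \<open>a\<close>,
      so it is neither in \<open>p2\<close> nor equal to \<open>h\<close>; and \<open>q2\<close>
      shares no edge with \<open>p\<close>.\<close>
    have f_nin: "oedge f \<notin> oedge ` set s"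
    proof -
      have "otrail B (p1 @ (a # p2 @ [h]))"
        using h(2) p_eq by simp
      then have "oedge f \<notin> oedge ` set (a # p2 @ [h])"
        using f_in unfolding otrail_append[of B p1] disjoint_iff by blast
      moreover have "oedge f \<notin> oedge ` set q2"
        using q2 fp by (metis imageE)
      ultimately show ?thesis
        by (simp add: s_def image_Un)
    qed
    have "oedge (hd s) \<in> Z \<or> accessible B Z f (hd s)"
    proof (unfold disj_imp, intro impI)
      assume "oedge (hd s) \<notin> Z"
      moreover have "oedge (hd s) \<noteq> oedge f"
        using ends_neq[OF f_nin] by simp
      moreover have "otail (hd s) = ohead a"
        using link_s(1) by (simp add: link_def)
      ultimately show "accessible B Z f (hd s)"
        using accessible_at[OF bl a_s(1) aZ s_or(1)] by blast
    qed
    moreover have "oedge (last s) \<in> Z \<or> accessible B Z f (oreverse (last s))"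
    proof (unfold disj_imp, intro impI)
      assume "oedge (last s) \<notin> Z"
      moreover have "oedge (last s) \<noteq> oedge f"
        using ends_neq[OF f_nin] by simp
      moreover have "otail (oreverse (last s)) = ohead b"
        using link_s(2) by (simp add: link_def)
      ultimately show "accessible B Z f (oreverse (last s))"
        using accessible_at[OF bl b_s(1), of "oreverse (last s)"] aZ ab s_or(2) by simp
    qed
    ultimately show ?thesis
      using f bl f_nin by blast
  qed
  then obtain f Z where fZ: "natural B r f" "blossom B f Z" "oedge f \<notin> oedge ` set s"
      "oedge (hd s) \<in> Z \<or> accessible B Z f (hd s)"
      "oedge (last s) \<in> Z \<or> accessible B Z f (oreverse (last s))"
    by blast
  have "blossom B f (Z \<union> oedge ` set s)"
    by (rule blossom_ear[OF fZ(2) s _ fZ(3-5)]) (simp add: s_def)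
  with fZ(1) show ?case
    by (intro exI[of _ f] exI[of _ "Z \<union> oedge ` set s"]) (simp add: s_def)
qed

lemma undir_in_blossom:
  assumes "undir B r h"
  obtains f Z where "natural B r f" "blossom B f Z" "oedge h \<in> Z"
  using undir_in_blossom_aux assms by (metis undir_def reached_def)

end

section \<open>Trail-undirectable components\<close>

context rooted_bidirected_graph
begin

abbreviation "comps \<equiv> trail_undirectable_components B r"

lemma undirectable_digraph_simps:
  "verts (trail_undirectable_digraph B r) =
     (\<Union>e\<in>{e \<in> bedges B. trail_undirectable B r e}. ends B e)"
  "arcs (trail_undirectable_digraph B r) =
     {a \<in> oriented_edges B. trail_undirectable B r (oedge a)}"
  "tail (trail_undirectable_digraph B r) = otail"
  "head (trail_undirectable_digraph B r) = ohead"
  by (auto simp: trail_undirectable_digraph_def symmetric_digraph_def edge_subgraph_def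
      oriented_edges_def)

lemma wf_undirectable_digraph: "wf_digraph (trail_undirectable_digraph B r)"
proof
  fix a
  assume "a \<in> arcs (trail_undirectable_digraph B r)"
  then have "a \<in> oriented_edges B" "trail_undirectable B r (oedge a)"
    by (simp_all add: undirectable_digraph_simps)
  then show "tail (trail_undirectable_digraph B r) a \<in> verts (trail_undirectable_digraph B r)"
    "head (trail_undirectable_digraph B r) a \<in> verts (trail_undirectable_digraph B r)"
    using oriented_edge_in_bverts[of a]
    unfolding undirectable_digraph_simps by blast+
qed

lemma undirectable_edge_in_component:
  assumes "a \<in> oriented_edges B" "trail_undirectable B r (oedge a)"
  shows "\<exists>C\<in>comps. otail a \<in> C \<and> ohead a \<in> C"
proof -
  interpret U: wf_digraph "trail_undirectable_digraph B r"
    by (rule wf_undirectable_digraph)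
  have dom: "otail b \<rightarrow>\<^bsub>trail_undirectable_digraph B r\<^esub> ohead b"
    if "b \<in> oriented_edges B" "oedge b = oedge a" for b
    using U.in_arcs_imp_in_arcs_ends[of b] that assms(2) by (simp add: undirectable_digraph_simps)
  have "otail a \<rightarrow>\<^bsub>trail_undirectable_digraph B r\<^esub> ohead a"
    "ohead a \<rightarrow>\<^bsub>trail_undirectable_digraph B r\<^esub> otail a"
    using dom[of a] dom[of "oreverse a"] assms by simp_all
  moreover have "otail a \<in> verts (trail_undirectable_digraph B r)"
    using U.tail_in_verts[of a] assms by (simp add: undirectable_digraph_simps)
  ultimately have "otail a \<in> verts (trail_undirectable_digraph B r)"
    "otail a \<in> U.scc_of (otail a)" "ohead a \<in> U.scc_of (otail a)"
    unfolding U.scc_of_def by auto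
  then show ?thesis
    using U.scc_of_in_sccs_verts unfolding trail_undirectable_components_def by blast
qed

text \<open>Let \<open>b\<close> be the first edge returning to \<open>r\<close>. The trail up to
  \<open>b\<close> and the one-edge trail \<open>oreverse b\<close> make its edge undirectable, so
  its component would contain \<open>r\<close>.\<close>

lemma edge_clean_no_return:
  assumes clean: "edge_clean B r" and p: "rtrail B r p" "a \<in> set p"
  shows "ohead a \<noteq> r"
proof
  assume "ohead a = r"
  then obtain p1 b p2 where p_eq: "p = p1 @ b # p2" and b: "ohead b = r"
    and p1: "\<forall>c\<in>set p1. ohead c \<noteq> r"
    using split_list_first_prop[of p "\<lambda>a. ohead a = r"] p(2) by blast
  then have pb: "rtrail B r (p1 @ [b])"
    using p(1) rtrail_prefix[of B r "p1 @ [b]" p2] by simp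
  have "r \<notin> ohead ` set p1"
    using p1 by (metis imageE)
  with pb have "root_trail B r (p1 @ [b])"
    by (simp add: root_trail_iff)
  then have "trail_reaches B r b"
    unfolding trail_reaches_def by (intro exI[of _ "p1 @ [b]"]) simp
  moreover have b_or: "b \<in> oriented_edges B"
    using pb by (simp add: rtrail_def otrail_append otrail_Cons)
  then have "root_trail B r [oreverse b]"
    using b by (simp add: root_trail_iff rtrail_def otrail_Cons)
  then have "trail_reaches B r (oreverse b)"
    unfolding trail_reaches_def by (intro exI[of _ "[oreverse b]"]) simp
  ultimately have "trail_undirectable B r (oedge b)"
    unfolding trail_undirectable_def using b_or by blast
  with undirectable_edge_in_component[OF b_or] b clean show False
    by (auto simp: edge_clean_def)
qed

end

section \<open>Components of an edge-clean graph\<close>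

locale clean_bidirected_graph = rooted_bidirected_graph B r
  for B :: "('v, 'e) bidirected_graph" and r :: 'v +
  assumes clean: "edge_clean B r"

sublocale clean_bidirected_graph \<subseteq> no_return_graph
  by unfold_locales (rule edge_clean_no_return[OF clean])

context clean_bidirected_graph
begin

text \<open>As no trail from \<open>r\<close> returns, the condition on internal vertices holds
  automatically.\<close>

lemma trail_reaches_iff: "trail_reaches B r a \<longleftrightarrow> reached B r a"
proof
  assume "trail_reaches B r a"
  then obtain p where "rtrail B r p" "p \<noteq> []" "last p = a"
    by (auto simp: trail_reaches_def root_trail_iff)
  then show "reached B r a"
    using reached_if_in_rtrail[of B r p a] by auto
next
  assume "reached B r a"
  then obtain p where p: "rtrail B r (p @ [a])"
    by (auto simp: reached_def)
  have "r \<notin> ohead ` set p"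
    using no_return[OF rtrail_prefix[OF p]] by (metis imageE)
  with p have "root_trail B r (p @ [a])"
    by (simp add: root_trail_iff)
  then show "trail_reaches B r a"
    unfolding trail_reaches_def by (intro exI[of _ "p @ [a]"]) simp
qed

lemma trail_undirectable_iff:
  assumes "a \<in> oriented_edges B"
  shows "trail_undirectable B r (oedge a) \<longleftrightarrow> undir B r a"
proof
  assume "trail_undirectable B r (oedge a)"
  then obtain b where "undir B r b" "oedge b = oedge a"
    by (auto simp only: trail_undirectable_def trail_reaches_iff undir_def)
  then show "undir B r a"
    using undir_oedge_cong assms by simp
next
  assume "undir B r a"
  then show "trail_undirectable B r (oedge a)"
    unfolding trail_undirectable_def trail_reaches_iff undir_def by blast
qed

lemma trail_directable_natural:
  assumes "natural B r a"
  shows "trail_directable B r (oedge a)" "natural_orientation B r (oedge a) = a"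
proof -
  have *: "b \<in> oriented_edges B \<and> oedge b = oedge a \<and> trail_reaches B r b \<longleftrightarrow> b = a" for b
    using assms oriented_edges_cases[of a b] unfolding natural_def trail_reaches_iff by metis
  show "trail_directable B r (oedge a)"
    unfolding trail_directable_def * by simp
  show "natural_orientation B r (oedge a) = a"
    unfolding natural_orientation_def * by simp
qed

lemma trail_directableE:
  assumes "e \<in> bedges B" "trail_directable B r e"
  obtains a where "natural B r a" "oedge a = e"
proof -
  from assms(2) obtain a where a: "a \<in> oriented_edges B" "oedge a = e" "trail_reaches B r a"
    and uniq: "\<And>b. b \<in> oriented_edges B \<and> oedge b = e \<and> trail_reaches B r b \<Longrightarrow> b = a"
    unfolding trail_directable_def by (elim ex1E) blast
  \<comment> \<open>Absence of loops makes the two orientations different.\<close>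
  have "oreverse a \<noteq> a"
    using otail_neq_ohead[OF a(1)] by (metis oreverse_simps(1))
  then have "natural B r a"
    using uniq[of "oreverse a"] a by (auto simp only: natural_def trail_reaches_iff
        oriented_edges_oreverse oreverse_simps)
  with a(2) that show ?thesis
    by blast
qed

lemma comps_disjoint:
  "C \<in> comps \<Longrightarrow> C' \<in> comps \<Longrightarrow> w \<in> C \<Longrightarrow> w \<in> C' \<Longrightarrow> C' = C"
  using wf_digraph.sccs_verts_disjoint[OF wf_undirectable_digraph]
  unfolding trail_undirectable_components_def by blast

lemma undir_in_comp: "undir B r a \<Longrightarrow> \<exists>C\<in>comps. otail a \<in> C \<and> ohead a \<in> C"
  using undirectable_edge_in_component trail_undirectable_iff by (simp add: undir_def)

lemma undir_comp_iff:
  assumes "undir B r a" "C \<in> comps"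
  shows "ohead a \<in> C \<longleftrightarrow> otail a \<in> C"
  using undir_in_comp[OF assms(1)] comps_disjoint[OF assms(2)] by blast

lemma root_notin_comp: "C \<in> comps \<Longrightarrow> r \<notin> C"
  using clean by (simp add: edge_clean_def)

lemma comp_vertex:
  assumes "C \<in> comps" "w \<in> C"
  obtains a where "undir B r a" "ohead a = w"
proof -
  have "w \<in> verts (trail_undirectable_digraph B r)"
    using wf_digraph.sccs_verts_subsets[OF wf_undirectable_digraph] assms
    unfolding trail_undirectable_components_def by blast
  then obtain e where e: "e \<in> bedges B" "trail_undirectable B r e" "w \<in> ends B e"
    by (auto simp: undirectable_digraph_simps)
  obtain a where a: "a \<in> oriented_edges B" "oedge a = e"
    using obtain_orientation[OF e(1)] .
  then have und: "undir B r a"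
    using e(2) trail_undirectable_iff[OF a(1)] by simp
  have "w = ohead a \<or> w = ohead (oreverse a)"
    using oriented_edge_in_bverts[OF a(1)] a(2) e(3) by auto
  with und that[of a] that[of "oreverse a"] show ?thesis
    by auto
qed

lemma undir_trail_comp:
  "otrail B (q @ [a]) \<Longrightarrow> \<forall>b\<in>set (q @ [a]). undir B r b \<Longrightarrow> C \<in> comps \<Longrightarrow> ohead a \<in> C \<Longrightarrow>
     otail (hd (q @ [a])) \<in> C"
proof (induction q)
  case (Cons b q)
  then have "otail (hd (q @ [a])) \<in> C" "ohead b = otail (hd (q @ [a]))"
    by (simp_all add: otrail_Cons link_def)
  with Cons.prems(2,3) undir_comp_iff[of b C] show ?case
    by simp
qed (simp add: undir_comp_iff)

text \<open>Existence: a trail inside a blossom from its base to an edge with head in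
  \<open>C\<close> uses only undirectable edges and so stays in \<open>C\<close>; hence the base
  enters \<open>C\<close>. Uniqueness: blossoms that meet share their base, so \<open>C\<close> is
  covered by blossoms with base \<open>f\<close>, and any entering edge heads into one of
  them.\<close>

lemma comp_entry:
  assumes C: "C \<in> comps"
  obtains f where "natural B r f" "ohead f \<in> C" "\<And>g. natural B r g \<Longrightarrow> ohead g \<in> C \<Longrightarrow> g = f"
proof -
  interpret U: wf_digraph "trail_undirectable_digraph B r"
    by (rule wf_undirectable_digraph)
  have "C \<noteq> {}" and conn: "\<forall>u\<in>C. \<forall>v\<in>C. u \<rightarrow>\<^sup>*\<^bsub>trail_undirectable_digraph B r\<^esub> v"
    using C unfolding trail_undirectable_components_def U.in_sccs_verts_conv_reachable by blast+
  then obtain w where w: "w \<in> C"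
    by blast
  obtain a where a: "undir B r a" "ohead a = w"
    using comp_vertex[OF C w] .
  obtain f Z where f: "natural B r f" and bl: "blossom B f Z" "oedge a \<in> Z"
    using undir_in_blossom[OF a(1)] .
  have Z: "Z \<subseteq> bedges B"
    using bl(1) by (simp add: blossom_def)
  have a_or: "a \<in> oriented_edges B"
    using a(1) by (simp add: undir_def)
  obtain q where q: "otrail B (f # q @ [a])" "oedge ` set q \<subseteq> Z"
    using bl a_or unfolding blossom_def accessible_def by blast
  have qa: "otrail B (q @ [a])"
    using q(1) by (simp add: otrail_Cons)
  have "\<forall>b\<in>set (q @ [a]). undir B r b"
  proof
    fix b
    assume b: "b \<in> set (q @ [a])"
    then have "oedge b \<in> Z"
      using q(2) bl(2) by auto
    then show "undir B r b"
      using blossom_undir[OF bl(1) f otrail_in_oriented_edges[OF qa b]] by blast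
  qed
  from undir_trail_comp[OF qa this C] have "otail (hd (q @ [a])) \<in> C"
    using a(2) w by simp
  then have fC: "ohead f \<in> C"
    using q(1) by (simp add: otrail_Cons link_def)
  \<comment> \<open>Induction along a walk in the component: the next edge lies in a blossom of its
    own, which meets the previous one at \<open>u\<close>.\<close>
  have "\<exists>Z. blossom B f Z \<and> v \<in> bl_verts Z" if "w \<rightarrow>\<^sup>*\<^bsub>trail_undirectable_digraph B r\<^esub> v" for v
    using that
  proof (induction rule: U.reachable_induct)
    case base
    show ?case
      using bl bl_vertsI[OF Z a_or bl(2)] a(2) by blast
  next
    case (step u v)
    obtain Z1 where Z1: "blossom B f Z1" "u \<in> bl_verts Z1"
      using step.IH by blast
    obtain b where "b \<in> arcs (trail_undirectable_digraph B r)" and uv: "otail b = u" "ohead b = v"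
      using step.hyps(2) by (auto simp only: arcs_ends_conv undirectable_digraph_simps)
    then have b: "b \<in> oriented_edges B" "undir B r b"
      using trail_undirectable_iff[of b] by (simp_all add: undirectable_digraph_simps)
    obtain f' Z' where f': "natural B r f'" "blossom B f' Z'" "oedge b \<in> Z'"
      using undir_in_blossom[OF b(2)] .
    have Z': "Z' \<subseteq> bedges B"
      using f'(2) by (simp add: blossom_def)
    have "f' = f"
      using blossom_base_eq[OF Z1(1) f f'(2,1) Z1(2)] bl_vertsI[OF Z' b(1) f'(3)] uv by blast
    with f'(2) bl_vertsI[OF Z' b(1) f'(3)] uv show ?case
      by blast
  qed
  then have "g = f" if "natural B r g" "ohead g \<in> C" for g
    using that conn w blossom_base_unique[OF _ _ f] unfolding bl_verts_def
    by (metis UN_E empty_iff)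
  with f fC that show ?thesis
    by blast
qed

lemma component_entry_eq:
  assumes C: "C \<in> comps" and f: "natural B r f" "ohead f \<in> C"
  shows "component_entry B r C = oedge f" "component_root B r C = ohead f"
proof -
  have uniq: "g = f" if "natural B r g" "ohead g \<in> C" for g
    using comp_entry[OF C] that f by metis
  show entry: "component_entry B r C = oedge f"
    unfolding component_entry_def
  proof (rule the_equality)
    show "oedge f \<in> bedges B \<and> trail_directable B r (oedge f) \<and>
        ohead (natural_orientation B r (oedge f)) \<in> C"
      using f trail_directable_natural[OF f(1)] oriented_edge_in_bverts by (simp add: natural_def)
  next
    fix e
    assume e: "e \<in> bedges B \<and> trail_directable B r e \<and> ohead (natural_orientation B r e) \<in> C"
    then obtain g where "natural B r g" "oedge g = e"
      using trail_directableE by blast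
    with e uniq[of g] trail_directable_natural(2)[of g] show "e = oedge f"
      by auto
  qed
  show "component_root B r C = ohead f"
    unfolding component_root_def entry trail_directable_natural(2)[OF f(1)]
    using root_notin_comp[OF C] by simp
qed

section \<open>Projection onto the skeleton\<close>

abbreviation "proj \<equiv> skeleton_proj B r"

lemma proj_out: "\<forall>C\<in>comps. w \<notin> C \<Longrightarrow> proj w = w"
  by (simp add: skeleton_proj_def)

lemma proj_in:
  assumes C: "C \<in> comps" "w \<in> C" and f: "natural B r f" "ohead f \<in> C"
  shows "proj w = ohead f"
proof -
  have "(THE C. C \<in> comps \<and> w \<in> C) = C"
    using C comps_disjoint by (intro the_equality) blast+
  with C component_entry_eq[OF C(1) f] show ?thesis
    by (auto simp: skeleton_proj_def)
qed

lemma proj_in_comp_iff: "C \<in> comps \<Longrightarrow> proj w \<in> C \<longleftrightarrow> w \<in> C"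
  by (metis comp_entry comps_disjoint proj_in proj_out)

lemma proj_undir: "undir B r a \<Longrightarrow> proj (ohead a) = proj (otail a)"
  by (metis comp_entry proj_in undir_in_comp)

text \<open>A natural edge heading into a component is its entering edge, and the component is
  contracted to exactly that head.\<close>

lemma proj_ohead_natural: "natural B r a \<Longrightarrow> proj (ohead a) = ohead a"
  by (metis proj_in proj_out)

lemma proj_eq_root_iff: "proj w = r \<longleftrightarrow> w = r"
  by (metis proj_out proj_in_comp_iff root_notin_comp)

lemma proj_root: "proj r = r"
  by (simp add: proj_eq_root_iff)

lemma proj_proj: "proj (proj w) = proj w"
  by (metis comp_entry proj_in proj_in_comp_iff proj_out)

text \<open>Charges an edge inside a component to the arc entering that component, and an arc to
  itself. Equal edges have equal charges, so lifts with disjoint charges are edge-disjoint.\<close>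

definition entry :: "'e \<Rightarrow> 'e" where
  "entry e = (if trail_directable B r e then e
     else component_entry B r (THE C. C \<in> comps \<and> ends B e \<subseteq> C))"

lemma entry_natural: "natural B r a \<Longrightarrow> entry (oedge a) = oedge a"
  using trail_directable_natural by (simp add: entry_def)

lemma entry_undir:
  assumes a: "undir B r a" and C: "C \<in> comps" "ohead a \<in> C" and f: "natural B r f" "ohead f \<in> C"
  shows "entry (oedge a) = oedge f"
proof -
  have a_or: "a \<in> oriented_edges B"
    using a by (simp add: undir_def)
  have "\<not> trail_directable B r (oedge a)"
  proof
    assume "trail_directable B r (oedge a)"
    then obtain b where "natural B r b" "oedge b = oedge a"
      using trail_directableE oriented_edge_in_bverts[OF a_or] by blast
    with undir_oedge_cong[OF a, of b] not_natural_if_undir[of B r b] show False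
      by (simp add: natural_def)
  qed
  moreover have "(THE C. C \<in> comps \<and> ends B (oedge a) \<subseteq> C) = C"
  proof (rule the_equality)
    show "C \<in> comps \<and> ends B (oedge a) \<subseteq> C"
      using C undir_comp_iff[OF a C(1)] oriented_edge_in_bverts[OF a_or] by simp
  next
    fix C'
    assume "C' \<in> comps \<and> ends B (oedge a) \<subseteq> C'"
    with C oriented_edge_in_bverts[OF a_or] show "C' = C"
      using comps_disjoint[of C C' "ohead a"] by simp
  qed
  ultimately show ?thesis
    using component_entry_eq[OF C(1) f] by (simp add: entry_def)
qed

text \<open>Relates charges to vertices: the charged arc ends where the head of the edge is
  projected.\<close>

lemma entry_reached:
  assumes "reached B r a"
  obtains f where "natural B r f" "entry (oedge a) = oedge f" "proj (ohead a) = ohead f"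
proof (cases "natural B r a")
  case True
  with that[of a] show ?thesis
    by (simp add: entry_natural proj_ohead_natural)
next
  case False
  with assms have a: "undir B r a"
    using natural_or_undir by blast
  then obtain C where C: "C \<in> comps" "ohead a \<in> C"
    using undir_in_comp by blast
  obtain f where "natural B r f" "ohead f \<in> C"
    using comp_entry[OF C(1)] .
  with that[of f] entry_undir[OF a C] proj_in[OF C] show ?thesis
    by blast
qed

text \<open>
  If two naturally oriented edges did not link up at a vertex outside all components, then the
  edge preceding the second one could be traversed backwards after the first one, or vice versa.
\<close>

lemma natural_link:
  assumes a: "natural B r a" and b: "natural B r b"
    and ab: "ohead a = otail b" and out: "\<forall>C\<in>comps. ohead a \<notin> C"
  shows "link B a b"
proof (rule ccontr)
  assume "\<not> link B a b"
  then have sgn_ab: "sgn_of B (oedge b) (ohead a) = sgn_of B (oedge a) (ohead a)"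
    using ab neq_imp_eq_opp by (auto simp: link_def)
  obtain p where p: "rtrail B r (p @ [a])"
    using a reached_natural by blast
  have a_or: "a \<in> oriented_edges B"
    using a by (simp add: natural_def)
  have nr: "ohead a \<noteq> r"
    using no_return[OF p, of a] by simp
  obtain q where q: "rtrail B r (q @ [b])"
    using b reached_natural by blast
  have "q \<noteq> []"
    using q nr ab by (auto simp: rtrail_def)
  \<comment> \<open>\<open>g\<close> precedes \<open>b\<close> on a trail to \<open>b\<close>; it
    exists because \<open>otail b\<close> differs from \<open>r\<close>.\<close>
  then obtain q' g where q_eq: "q = q' @ [g]"
    by (cases q rule: rev_cases) auto
  have gb: "link B g b"
    using q q_eq by (simp add: rtrail_def otrail_append otrail_Cons)
  then have g_head: "ohead g = ohead a"
    using ab by (simp add: link_def)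
  \<comment> \<open>\<open>b\<close> can follow \<open>g\<close> but not \<open>a\<close>, so
    \<open>a\<close> and \<open>g\<close> have opposite signs at their common head: each can be
    followed by the reversal of the other.\<close>
  have sgn_g: "sgn_of B (oedge a) (ohead a) = opp (sgn_of B (oedge g) (ohead a))"
    using gb unfolding link_def g_head sgn_ab by blast
  have "reached B r g"
    using reached_if_in_rtrail[OF q, of g] q_eq by simp
  moreover have "\<not> undir B r g"
    using undir_in_comp[of g] out g_head by auto
  ultimately have g: "natural B r g"
    using natural_or_undir by blast
  have g_or: "g \<in> oriented_edges B"
    using g by (simp add: natural_def)
  have neq: "oedge g \<noteq> oedge a"
    using sgn_g by (cases "sgn_of B (oedge g) (ohead a)") auto
  show False
  \<comment> \<open>If \<open>g\<close> is not on the trail to \<open>a\<close>, append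
    \<open>oreverse g\<close> to that trail; otherwise stop at \<open>g\<close> and append
    \<open>oreverse a\<close>.\<close>
  proof (cases "oedge g \<in> oedge ` set p")
    case False
    have "otrail B ((p @ [a]) @ [oreverse g])"
      unfolding otrail_append[of B "p @ [a]"] using p False neq g_or g_head sgn_g
      by (simp add: rtrail_def otrail_Cons link_def)
    then have "rtrail B r ((p @ [a]) @ [oreverse g])"
      using p rtrail_append[of "p @ [a]"] by blast
    with g show False
      unfolding natural_def reached_def by blast
  next
    case True
    then have "g \<in> set p"
      using natural_in_rtrail[OF g rtrail_prefix[OF p]] by blast
    then obtain p1 p2 where p_eq: "p = p1 @ g # p2"
      by (blast dest: split_list)
    then have pg: "rtrail B r (p1 @ [g])"
      using p rtrail_prefix[of B r "p1 @ [g]" "p2 @ [a]"] by simp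
    have "oedge a \<notin> oedge ` set p1"
      using p p_eq by (simp add: rtrail_def otrail_append otrail_Cons image_Un)
    then have "otrail B ((p1 @ [g]) @ [oreverse a])"
      unfolding otrail_append[of B "p1 @ [g]"] using pg neq a_or g_head sgn_g
      by (simp add: rtrail_def otrail_Cons link_def)
    then have "rtrail B r ((p1 @ [g]) @ [oreverse a])"
      using pg rtrail_append[of "p1 @ [g]"] by blast
    with a show False
      unfolding natural_def reached_def by blast
  qed
qed

end

section \<open>Comparing edge-connectivities\<close>

lemma finite_max_edge_disjoint:
  assumes "finite T"
  shows "finite {card P |P. P \<subseteq> T \<and> finite P \<and> pairwise (\<lambda>p q. E p \<inter> E q = {}) P}"
proof (rule finite_subset)
  show "{card P |P. P \<subseteq> T \<and> finite P \<and> pairwise (\<lambda>p q. E p \<inter> E q = {}) P} \<subseteq> {..card T}"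
    using assms by (auto intro: card_mono)
qed simp

text \<open>Choose a \<open>q\<close> for every \<open>p\<close>. An edge common to two chosen sets
  would be carried by \<open>g\<close> into both original sets, so disjointness transfers;
  non-emptiness keeps the choice injective. Used with the identity for projections and with
  \<open>entry\<close> for lifts.\<close>

lemma max_edge_disjoint_mono:
  assumes fin: "finite T" "finite T'"
    and ex: "\<And>p. p \<in> T \<Longrightarrow> \<exists>q\<in>T'. E' q \<noteq> {} \<and> g ` E' q \<subseteq> E p"
  shows "max_edge_disjoint E T \<le> max_edge_disjoint E' T'"
proof -
  have "max_edge_disjoint E T \<in>
      {card P |P. P \<subseteq> T \<and> finite P \<and> pairwise (\<lambda>p q. E p \<inter> E q = {}) P}"
    unfolding max_edge_disjoint_def
    by (rule Max_in[OF finite_max_edge_disjoint[OF fin(1)]])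
      (auto intro!: exI[of _ "{}"])
  then obtain P where P: "P \<subseteq> T" "finite P" "pairwise (\<lambda>p q. E p \<inter> E q = {}) P"
    and max: "max_edge_disjoint E T = card P"
    by blast
  obtain h where h: "\<And>p. p \<in> T \<Longrightarrow> h p \<in> T' \<and> E' (h p) \<noteq> {} \<and> g ` E' (h p) \<subseteq> E p"
    using ex by metis
  have disj: "E' (h p) \<inter> E' (h q) = {}" if "p \<in> P" "q \<in> P" "p \<noteq> q" for p q
  proof -
    have "E p \<inter> E q = {}"
      using P(3) that by (auto simp: pairwise_def)
    moreover have "g ` E' (h p) \<subseteq> E p" "g ` E' (h q) \<subseteq> E q"
      using h P(1) that by blast+
    ultimately show ?thesis
      by blast
  qed
  have "inj_on h P"
  proof (rule inj_onI, rule ccontr)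
    fix p q
    assume "p \<in> P" "q \<in> P" "h p = h q" "p \<noteq> q"
    with disj[of p q] h[of p] P(1) show False
      by auto
  qed
  then have card: "card (h ` P) = card P"
    by (rule card_image)
  have "pairwise (\<lambda>p q. E' p \<inter> E' q = {}) (h ` P)"
  proof (rule pairwiseI)
    fix p' q'
    assume "p' \<in> h ` P" "q' \<in> h ` P" "p' \<noteq> q'"
    then obtain p q where "p' = h p" "q' = h q" "p \<in> P" "q \<in> P" "p \<noteq> q"
      by blast
    with disj show "E' p' \<inter> E' q' = {}"
      by blast
  qed
  moreover have "h ` P \<subseteq> T'" "finite (h ` P)"
    using h P(1,2) by auto
  ultimately have "card (h ` P) \<le> max_edge_disjoint E' T'"
    unfolding max_edge_disjoint_def by (intro Max_ge finite_max_edge_disjoint fin(2)) blast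
  with card max show ?thesis
    by simp
qed

text \<open>For equal endpoints, where only the trivial trail remains.\<close>

lemma max_edge_disjoint_singleton: "max_edge_disjoint E {t} = 1"
proof -
  have "{card P |P. P \<subseteq> {t} \<and> finite P \<and> pairwise (\<lambda>p q. E p \<inter> E q = {}) P} = {0, 1}"
    by (auto simp: subset_singleton_iff intro: exI[of _ "{}"] exI[of _ "{t}"])
  then show ?thesis
    by (simp add: max_edge_disjoint_def)
qed

section \<open>The trail-skeleton\<close>

context clean_bidirected_graph
begin

abbreviation "D \<equiv> trail_skeleton B r"

lemma skeleton_arcE:
  assumes "e \<in> arcs D"
  obtains a where "natural B r a" "oedge a = e"
proof -
  have "e \<in> bedges B" "trail_directable B r e"
    using assms by (simp_all add: trail_skeleton_def)
  then show ?thesis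
    using that by (rule trail_directableE)
qed

lemma skeleton_natural:
  assumes "natural B r a"
  shows "oedge a \<in> arcs D" "tail D (oedge a) = proj (otail a)" "head D (oedge a) = ohead a"
  using assms trail_directable_natural[OF assms] oriented_edge_in_bverts[of a]
    proj_ohead_natural[OF assms]
  by (simp_all add: trail_skeleton_def natural_def)

lemma proj_vert_skeleton: "x \<in> verts D \<Longrightarrow> proj x = x"
  by (auto simp: trail_skeleton_def proj_proj)

lemma wf_skeleton: "wf_digraph D"
proof
  fix e
  assume "e \<in> arcs D"
  then obtain a where a: "natural B r a" "oedge a = e"
    by (rule skeleton_arcE)
  have "proj (otail a) \<in> verts D" "proj (ohead a) \<in> verts D"
    using oriented_edge_in_bverts[of a] a(1) by (simp_all add: trail_skeleton_def natural_def)
  then show "tail D e \<in> verts D" "head D e \<in> verts D"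
    using skeleton_natural[OF a(1)] proj_ohead_natural[OF a(1)] a(2) by simp_all
qed

lemma finite_skeleton_arcs: "finite (arcs D)"
  using finite_bedges by (simp add: trail_skeleton_def)

lemma root_in_skeleton: "r \<in> verts D"
  using root_in_bverts imageI[of r "bverts B" proj] by (simp add: trail_skeleton_def proj_root)

lemma head_entry:
  assumes "reached B r a"
  shows "head D (entry (oedge a)) = proj (ohead a)"
proof -
  obtain f where "natural B r f" "entry (oedge a) = oedge f" "proj (ohead a) = ohead f"
    using entry_reached[OF assms] by blast
  then show ?thesis
    using skeleton_natural(3) by simp
qed

section \<open>Projecting trails to walks of the skeleton\<close>

lemma rtrail_snoc_otail:
  "rtrail B r (p @ [a]) \<Longrightarrow> otail a = (if p = [] then r else ohead (last p))"
  by (cases "p = []") (simp_all add: rtrail_def otrail_append link_def)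

text \<open>Undirectable edges are dropped, since both of their ends project to the same vertex;
  natural ones are kept as arcs.\<close>

lemma rtrail_to_awalk:
  "rtrail B r p \<Longrightarrow>
     \<exists>q. pre_digraph.awalk D r q (proj (if p = [] then r else ohead (last p))) \<and>
       set q \<subseteq> oedge ` set p"
proof (induction p rule: rev_induct)
  case Nil
  show ?case
    using root_in_skeleton
    by (intro exI[of _ "[]"]) (simp add: proj_root pre_digraph.awalk_def pre_digraph.cas.simps)
next
  case (snoc a p)
  have "otail a = (if p = [] then r else ohead (last p))"
    using snoc.prems by (rule rtrail_snoc_otail)
  then obtain q where q: "pre_digraph.awalk D r q (proj (otail a))" "set q \<subseteq> oedge ` set p"
    using snoc.IH rtrail_prefix[OF snoc.prems] by auto
  have "reached B r a"
    using snoc.prems by (auto simp: reached_def)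
  then consider "natural B r a" | "undir B r a"
    using natural_or_undir by blast
  then show ?case
  proof cases
    case 1
    then have "pre_digraph.awalk D r (q @ [oedge a]) (proj (ohead a))"
      using q(1) skeleton_natural[OF 1] proj_ohead_natural[OF 1]
      by (simp add: pre_digraph.awalk_snoc)
    with q(2) show ?thesis
      by (intro exI[of _ "q @ [oedge a]"]) auto
  next
    case 2
    with q show ?thesis
      by (intro exI[of _ q]) (auto simp: proj_undir)
  qed
qed

section \<open>Lifting skeleton paths\<close>

lemma path_reaches_rtrail:
  assumes "path_reaches B r a"
  obtains p where "rtrail B r (p @ [a])" "distinct (r # map ohead (p @ [a]))"
proof -
  obtain p w where p: "bpath B r p w" "p \<noteq> []" "last p = a"
    using assms by (auto simp: path_reaches_def)
  then have rt: "rtrail B r p"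
    by (simp add: bpath_def btrail_iff_rtrail)
  then have "distinct (r # map ohead p)"
    using p(1) by (simp add: bpath_def btrail_verts_eq)
  moreover have "p = butlast p @ [a]"
    using p(2,3) by (metis append_butlast_last_id)
  ultimately show ?thesis
    using that[of "butlast p"] rt by metis
qed

text \<open>Path-reachability yields a path to some orientation of the edge, and \<open>b\<close> is
  the only orientation reached by trails from \<open>r\<close>.\<close>

lemma natural_path_reached:
  assumes "path_reachable B r" and b: "natural B r b"
  obtains p where "rtrail B r (p @ [b])" "distinct (r # map ohead (p @ [b]))"
proof -
  have "oedge b \<in> bedges B"
    using b oriented_edge_in_bverts by (simp add: natural_def)
  then obtain c where c: "c \<in> oriented_edges B" "oedge c = oedge b" "path_reaches B r c"
    using assms(1) by (auto simp only: path_reachable_def)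
  obtain p where p: "rtrail B r (p @ [c])" "distinct (r # map ohead (p @ [c]))"
    using path_reaches_rtrail[OF c(3)] .
  then have "reached B r c"
    by (auto simp: reached_def)
  then have "c = b"
    using oriented_edges_cases[of b c] b c(1,2) unfolding natural_def by metis
  with p that show ?thesis
    by blast
qed

text \<open>Lifts the passage from one skeleton arc to the next. Outside the components the two
  edges link directly; inside a component \<open>s\<close> is the final segment of a trail to
  \<open>b\<close>. The flag \<open>pth\<close> asks for the version without repeated
  vertices.\<close>

lemma natural_connect:
  assumes a: "natural B r a" and b: "natural B r b" and ab: "ohead a = proj (otail b)"
    and pth: "pth \<Longrightarrow> path_reachable B r"
  shows "\<exists>s. otrail B (a # s @ [b]) \<and> (\<forall>c\<in>set s. entry (oedge c) = oedge a) \<and>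
    (pth \<longrightarrow> distinct (map ohead (a # s @ [b])))"
proof (cases "\<exists>C\<in>comps. otail b \<in> C")
  case False
  then have ab': "ohead a = otail b"
    using ab proj_out by simp
  with False have "link B a b"
    using natural_link[OF a b] by simp
  moreover have b_or: "a \<in> oriented_edges B" "b \<in> oriented_edges B"
    using a b by (simp_all add: natural_def)
  moreover have "ohead a \<noteq> ohead b"
    using ab' otail_neq_ohead[OF b_or(2)] by simp
  moreover have "oedge a \<noteq> oedge b"
    using natural_unique[OF a b] \<open>ohead a \<noteq> ohead b\<close> by blast
  ultimately show ?thesis
    by (intro exI[of _ "[]"]) (simp add: otrail_Cons)
next
  case True
  then obtain C where C: "C \<in> comps" "otail b \<in> C"
    by blast
  have aC: "ohead a \<in> C"
    using C proj_in_comp_iff ab by simp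
  have "\<exists>p. rtrail B r (p @ [b]) \<and> (pth \<longrightarrow> distinct (map ohead (p @ [b])))"
  proof (cases pth)
    case True
    with pth natural_path_reached[OF _ b] show ?thesis
      by (metis distinct.simps(2))
  next
    case False
    with reached_natural[OF b] show ?thesis
      by simp
  qed
  then obtain p where p: "rtrail B r (p @ [b])" "pth \<longrightarrow> distinct (map ohead (p @ [b]))"
    by blast
  \<comment> \<open>Followed backwards from \<open>b\<close>, undirectable edges never leave
    \<open>C\<close>.\<close>
  have into_C: "otail (hd (s @ [b])) \<in> C \<and> (\<forall>c\<in>set s. ohead c \<in> C)"
    if s: "otrail B (s @ [b])" "\<forall>c\<in>set s. undir B r c" for s
    using s
  proof (induction s)
    case Nil
    with C show ?case
      by simp
  next
    case (Cons c s)
    then have "otail (hd (s @ [b])) \<in> C" "\<forall>c\<in>set s. ohead c \<in> C"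
      "ohead c = otail (hd (s @ [b]))"
      by (simp_all add: otrail_Cons link_def)
    with Cons.prems(2) undir_comp_iff[OF _ C(1), of c] show ?case
      by simp
  qed
  have "\<exists>d\<in>set p. \<not> undir B r d"
  proof (rule ccontr)
    assume "\<not> ?thesis"
    then have "otail (hd (p @ [b])) \<in> C"
      using into_C[of p] p(1) by (simp add: rtrail_def)
    with p(1) root_notin_comp[OF C(1)] show False
      by (simp add: rtrail_def)
  qed
  \<comment> \<open>After \<open>d\<close>, the last edge of \<open>p\<close> that is not
    undirectable, the trail stays in \<open>C\<close> until \<open>b\<close>. So \<open>d\<close>
    enters \<open>C\<close> and is \<open>a\<close> by uniqueness.\<close>
  then obtain p1 d s where p_eq: "p = p1 @ d # s" and d: "\<not> undir B r d"
    and s: "\<forall>c\<in>set s. undir B r c"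
    using split_list_last_prop[of p "\<lambda>d. \<not> undir B r d"] by blast
  have "reached B r d"
    using reached_if_in_rtrail[OF p(1), of d] p_eq by simp
  with d have d_nat: "natural B r d"
    using natural_or_undir by blast
  have ds: "otrail B (d # s @ [b])"
    using p(1) p_eq otrail_append[of B p1 "d # s @ [b]"] by (simp add: rtrail_def)
  then have "otail (hd (s @ [b])) \<in> C" and sC: "\<forall>c\<in>set s. ohead c \<in> C"
    using into_C[OF _ s] by (simp_all add: otrail_Cons)
  with ds have "ohead d \<in> C"
    by (simp add: otrail_Cons link_def)
  then have "d = a"
    using comp_entry[OF C(1)] d_nat a aC by metis
  moreover have "\<forall>c\<in>set s. entry (oedge c) = oedge a"
    using entry_undir[OF _ C(1) _ a aC] s sC by blast
  ultimately show ?thesis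
    using ds p(2) p_eq by (intro exI[of _ s]) auto
qed

text \<open>The lift ends in the natural orientation of the last arc, and its other edges are
  charged to earlier arcs. The charge of the last arc thus stays free for the next segment.\<close>

lemma apath_lift:
  assumes pth: "pth \<Longrightarrow> path_reachable B r"
  shows "pre_digraph.apath D r q v \<Longrightarrow> q \<noteq> [] \<Longrightarrow>
    \<exists>p a. rtrail B r (p @ [a]) \<and> natural B r a \<and> oedge a = last q \<and>
      entry ` oedge ` set p \<subseteq> set (butlast q) \<and> (pth \<longrightarrow> distinct (r # map ohead (p @ [a])))"
proof (induction q arbitrary: v rule: rev_induct)
  case (snoc e q)
  have walk: "pre_digraph.awalk D r q (tail D e)" "e \<in> arcs D"
    using snoc.prems(1) by (simp_all add: pre_digraph.apath_def pre_digraph.awalk_snoc)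
  have verts: "pre_digraph.awalk_verts D r q' = r # map (head D) q'"
    if "pre_digraph.awalk D r q' w" for q' w
  proof -
    have "pre_digraph.cas D r q' w"
      using that by (simp add: pre_digraph.awalk_def)
    then show ?thesis
      using pre_digraph.awalk_verts_conv'[of D r q' w]
      by (cases q') (simp_all add: pre_digraph.cas.simps)
  qed
  have dist: "distinct (r # map (head D) (q @ [e]))"
    using snoc.prems(1) verts[of "q @ [e]" v] by (simp add: pre_digraph.apath_def)
  then have path: "pre_digraph.apath D r q (tail D e)"
    using walk verts[OF walk(1)] by (simp add: pre_digraph.apath_def)
  \<comment> \<open>A directed path repeats no vertex, so its arcs are determined by their
    heads.\<close>
  have dist_arcs: "distinct (q @ [e])" "inj_on (head D) (set (q @ [e]))"
    using dist by (simp_all only: distinct.simps distinct_map)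
  obtain b where b: "natural B r b" "oedge b = e"
    using walk(2) by (rule skeleton_arcE)
  have b_or: "b \<in> oriented_edges B"
    using b by (simp add: natural_def)
  have tail_e: "tail D e = proj (otail b)"
    using skeleton_natural(2)[OF b(1)] b(2) by simp
  show ?case
  proof (cases "q = []")
    case True
    have "proj (otail b) = r"
      using walk(1) tail_e True by (simp add: pre_digraph.awalk_def pre_digraph.cas.simps)
    then have "otail b = r"
      by (simp add: proj_eq_root_iff)
    then have rt: "rtrail B r ([] @ [b])"
      using b_or by (simp add: rtrail_def otrail_Cons)
    have "ohead b \<noteq> r"
      using no_return[OF rt] by simp
    with rt b True show ?thesis
      by (intro exI[of _ "[]"] exI[of _ b]) simp
  next
    case False
    obtain p a where p: "rtrail B r (p @ [a])" and a: "natural B r a" "oedge a = last q"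
      and p_entry: "entry ` oedge ` set p \<subseteq> set (butlast q)"
      and p_dist: "pth \<longrightarrow> distinct (r # map ohead (p @ [a]))"
      using snoc.IH[OF path False] by blast
    have "head D (last q) = tail D e"
    proof -
      obtain q' e' where q_eq: "q = q' @ [e']"
        using False by (cases q rule: rev_cases) auto
      with walk(1) show ?thesis
        by (simp add: pre_digraph.awalk_snoc)
    qed
    then have "ohead a = proj (otail b)"
      using skeleton_natural(3)[OF a(1)] a(2) tail_e by simp
    from natural_connect[OF a(1) b(1) this pth]
    obtain s where s: "otrail B (a # s @ [b])" "\<forall>c\<in>set s. entry (oedge c) = oedge a"
        "pth \<longrightarrow> distinct (map ohead (a # s @ [b]))"
      by blast
    \<comment> \<open>The new segment is charged to the last arc of \<open>q\<close> and to
      \<open>e\<close>, neither of which occurs earlier on the path.\<close>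
    have s_entry: "entry (oedge c) \<in> {last q, e}" if "c \<in> set (a # s @ [b])" for c
      using that s(2) entry_natural[OF a(1)] entry_natural[OF b(1)] a(2) b(2) by auto
    have "distinct (butlast q @ [last q])"
      using dist_arcs(1) False by simp
    then have "last q \<notin> set (butlast q)"
      by simp
    moreover have "e \<notin> set (butlast q)"
      using dist_arcs(1) in_set_butlastD by fastforce
    ultimately have s_nin: "entry (oedge c) \<notin> set (butlast q)" if "c \<in> set (a # s @ [b])" for c
      using s_entry[OF that] by auto
    have disj: "oedge ` set p \<inter> oedge ` set (a # s @ [b]) = {}"
    proof (rule image_disjointI)
      fix c
      assume "c \<in> set (a # s @ [b])"
      from s_nin[OF this] p_entry show "oedge c \<notin> oedge ` set p"
        by (metis imageI subsetD)
    qed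
    have "otrail B (p @ a # s @ [b])"
      unfolding otrail_append[of B p]
      using p s(1) disj otrail_append[of B p "[a]"] by (simp add: rtrail_def)
    then have rt: "rtrail B r ((p @ a # s) @ [b])"
      using p by (cases p) (simp_all add: rtrail_def)
    have "entry ` oedge ` set (p @ a # s) \<subseteq> set q"
    proof -
      have "entry ` oedge ` set p \<subseteq> set q"
        using p_entry in_set_butlastD by fast
      moreover have "entry ` oedge ` set (a # s) \<subseteq> set q"
        using s(2) entry_natural[OF a(1)] a(2) last_in_set[OF False] by auto
      ultimately show ?thesis
        unfolding set_append image_Un by (rule Un_least)
    qed
    moreover have "distinct (r # map ohead ((p @ a # s) @ [b]))" if pth
    proof -
      \<comment> \<open>By \<open>head_entry\<close> a common head of edges gives charged arcs with
        the same head, hence equal ones, although \<open>p\<close> and the new segment have disjoint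
        charges.\<close>
      have neq: "ohead c \<noteq> ohead d" if c: "c \<in> set (a # s @ [b])" and d: "d \<in> set p" for c d
      proof
        assume "ohead c = ohead d"
        moreover have "reached B r c" "reached B r d"
          using reached_if_in_rtrail[OF rt, of c] reached_if_in_rtrail[OF rt, of d] c d by auto
        ultimately have "head D (entry (oedge c)) = head D (entry (oedge d))"
          using head_entry by simp
        moreover have "entry (oedge d) \<in> set (butlast q)"
          using p_entry d by blast
        moreover have "entry (oedge d) \<in> set (q @ [e])"
          using \<open>entry (oedge d) \<in> set (butlast q)\<close> by (auto dest: in_set_butlastD)
        moreover have "entry (oedge c) \<in> set (q @ [e])"
          using s_entry[OF c] False by auto
        ultimately have "entry (oedge c) \<in> set (butlast q)"
          using dist_arcs(2) by (metis inj_onD)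
        with s_nin[OF c] show False
          by simp
      qed
      have "ohead ` set p \<inter> ohead ` set (a # s @ [b]) = {}"
        by (rule image_disjointI) (use neq in \<open>metis imageE\<close>)
      moreover have "r \<notin> ohead ` set (p @ a # s @ [b])"
        using no_return[OF rt] by (metis append.assoc append_Cons imageE)
      moreover have "distinct (map ohead p)"
        using p_dist that by simp
      ultimately show ?thesis
        using s(3) that by (simp add: image_Un)
    qed
    ultimately show ?thesis
      using rt b by (intro exI[of _ "p @ a # s"] exI[of _ b]) auto
  qed
qed simp

section \<open>Comparison of the maxima\<close>

lemma finite_btrails: "finite {p. btrail B r p x}"
proof (rule finite_subset)
  show "{p. btrail B r p x} \<subseteq> {p. set p \<subseteq> oriented_edges B \<and> distinct p}"
    by (auto simp: btrail_iff_rtrail rtrail_def otrail_def distinct_map)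
qed (rule finite_subset_distinct[OF finite_oriented_edges])

lemma apath_distinct:
  assumes "pre_digraph.apath D r q x"
  shows "distinct q"
proof (cases "q = []")
  case False
  then have "distinct (map (tail D) q)"
    using assms by (simp add: pre_digraph.apath_def pre_digraph.awalk_verts_conv)
  then show ?thesis
    by (simp add: distinct_map)
qed simp

lemma finite_apaths: "finite {q. pre_digraph.apath D r q x}"
proof (rule finite_subset)
  show "{q. pre_digraph.apath D r q x} \<subseteq> {q. set q \<subseteq> arcs D \<and> distinct q}"
    using apath_distinct by (auto simp: pre_digraph.apath_def pre_digraph.awalk_def)
qed (rule finite_subset_distinct[OF finite_skeleton_arcs])

lemma bpaths_subset: "{p. bpath B r p x} \<subseteq> {p. btrail B r p x}"
  by (auto simp: bpath_def)

text \<open>A skeleton vertex is its own projection, so the projected walk ends in \<open>x\<close>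
  and can be shortened to a path.\<close>

lemma apath_from_btrail:
  assumes p: "btrail B r p x" and x: "x \<in> verts D" "x \<noteq> r"
  shows "\<exists>q. pre_digraph.apath D r q x \<and> q \<noteq> [] \<and> set q \<subseteq> oedge ` set p"
proof -
  interpret D: wf_digraph D
    by (rule wf_skeleton)
  have "rtrail B r p" "x = (if p = [] then r else ohead (last p))"
    using p by (simp_all only: btrail_iff_rtrail)
  then obtain q where q: "D.awalk r q x" "set q \<subseteq> oedge ` set p"
    using rtrail_to_awalk proj_vert_skeleton[OF x(1)] by metis
  have apath: "D.apath r (D.awalk_to_apath q) x"
    using q(1) by (rule D.apath_awalk_to_apath)
  moreover have "D.awalk_to_apath q \<noteq> []"
    using apath x(2) by (auto simp: D.apath_Nil_iff)
  moreover have "set (D.awalk_to_apath q) \<subseteq> oedge ` set p"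
    using D.awalk_to_apath_subset[OF q(1)] q(2) by blast
  ultimately show ?thesis
    by blast
qed

lemma btrail_from_apath:
  assumes q: "pre_digraph.apath D r q x" and x: "x \<noteq> r" and pth: "pth \<Longrightarrow> path_reachable B r"
  shows "\<exists>p. btrail B r p x \<and> (pth \<longrightarrow> bpath B r p x) \<and> p \<noteq> [] \<and>
    entry ` oedge ` set p \<subseteq> set q"
proof -
  have "q \<noteq> []"
    using q x by (auto simp: pre_digraph.apath_def pre_digraph.awalk_def pre_digraph.cas.simps)
  with apath_lift[OF pth q] obtain p a where p: "rtrail B r (p @ [a])"
    and a: "natural B r a" "oedge a = last q"
    and p_entry: "entry ` oedge ` set p \<subseteq> set (butlast q)"
    and dist: "pth \<longrightarrow> distinct (r # map ohead (p @ [a]))"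
    by blast
  have "head D (last q) = x"
  proof -
    obtain q' e' where q_eq: "q = q' @ [e']"
      using \<open>q \<noteq> []\<close> by (cases q rule: rev_cases) auto
    with q show ?thesis
      by (simp add: pre_digraph.apath_def pre_digraph.awalk_snoc)
  qed
  then have "ohead a = x"
    using skeleton_natural(3)[OF a(1)] a(2) by simp
  then have bt: "btrail B r (p @ [a]) x"
    using p by (simp add: btrail_iff_rtrail)
  moreover have "pth \<longrightarrow> bpath B r (p @ [a]) x"
    using bt dist btrail_verts_eq[OF p] by (simp add: bpath_def)
  moreover have "entry ` oedge ` set (p @ [a]) \<subseteq> set q"
  proof -
    have "entry ` oedge ` set p \<subseteq> set q"
      using p_entry in_set_butlastD by fast
    moreover have "entry ` oedge ` set [a] \<subseteq> set q"
      using entry_natural[OF a(1)] a(2) last_in_set[OF \<open>q \<noteq> []\<close>] by simp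
    ultimately show ?thesis
      unfolding set_append image_Un by (rule Un_least)
  qed
  ultimately show ?thesis
    by blast
qed

lemma btrail_root_iff: "btrail B r p r \<longleftrightarrow> p = []"
proof
  show "p = []" if "btrail B r p r"
    using that no_return[of p "last p"] by (auto simp: btrail_iff_rtrail split: if_splits)
qed (simp add: btrail_iff_rtrail rtrail_def)

lemma apath_root_iff: "pre_digraph.apath D r q r \<longleftrightarrow> q = []"
proof
  assume q: "pre_digraph.apath D r q r"
  show "q = []"
  proof (rule ccontr)
    assume "q \<noteq> []"
    with apath_lift[of False, OF _ q] obtain p a where p: "rtrail B r (p @ [a])"
      and a: "natural B r a" "oedge a = last q"
      by blast
    obtain q' e' where "q = q' @ [e']"
      using \<open>q \<noteq> []\<close> by (cases q rule: rev_cases) auto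
    with q have "head D (last q) = r"
      by (simp add: pre_digraph.apath_def pre_digraph.awalk_snoc)
    then have "ohead a = r"
      using skeleton_natural(3)[OF a(1)] a(2) by simp
    with no_return[OF p, of a] show False
      by simp
  qed
qed (simp add: pre_digraph.apath_def pre_digraph.awalk_def pre_digraph.cas.simps
    pre_digraph.awalk_verts.simps root_in_skeleton)

text \<open>Treats both equalities at once: \<open>T\<close> is the set of trails or, in a
  path-reachable graph, the set of paths.\<close>

lemma lambda_skeleton:
  assumes T: "{p. bpath B r p x} \<subseteq> T" "T \<subseteq> {p. btrail B r p x}"
    and T_cases: "T = {p. btrail B r p x} \<or> T = {p. bpath B r p x} \<and> path_reachable B r"
    and x: "x \<in> verts D"
  shows "max_edge_disjoint (\<lambda>p. oedge ` set p) T = lambda_digraph D r x"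
proof (cases "x = r")
  case True
  \<comment> \<open>For \<open>x = r\<close> only the trivial trail and the trivial directed path
    exist, so both maxima are 1.\<close>
  have "bpath B r [] r"
    using btrail_verts_eq[of "[]"] by (simp add: bpath_def btrail_iff_rtrail rtrail_def)
  then have "T = {[]}"
    using T True btrail_root_iff by blast
  then show ?thesis
    using True by (simp add: lambda_digraph_def apath_root_iff max_edge_disjoint_singleton)
next
  case False
  have fin: "finite T"
    using T(2) finite_btrails by (rule finite_subset)
  show ?thesis
  proof (rule antisym)
    show "max_edge_disjoint (\<lambda>p. oedge ` set p) T \<le> lambda_digraph D r x"
      unfolding lambda_digraph_def
    proof (rule max_edge_disjoint_mono[OF fin finite_apaths, where g = "\<lambda>e. e"])
      fix p
      assume "p \<in> T"
      with T(2) have "btrail B r p x"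
        by blast
      from apath_from_btrail[OF this x False]
      show "\<exists>q\<in>{q. pre_digraph.apath D r q x}. set q \<noteq> {} \<and> (\<lambda>e. e) ` set q \<subseteq> oedge ` set p"
        by simp
    qed
    show "lambda_digraph D r x \<le> max_edge_disjoint (\<lambda>p. oedge ` set p) T"
      unfolding lambda_digraph_def
    proof (rule max_edge_disjoint_mono[OF finite_apaths fin, where g = entry])
      fix q
      assume "q \<in> {q. pre_digraph.apath D r q x}"
      then have q: "pre_digraph.apath D r q x"
        by simp
      \<comment> \<open>The flag requests a path exactly if \<open>T\<close> is not the set of all
        trails; then \<open>T_cases\<close> provides path-reachability.\<close>
      obtain p where p: "btrail B r p x" "T \<noteq> {p. btrail B r p x} \<longrightarrow> bpath B r p x" "p \<noteq> []"
          "entry ` oedge ` set p \<subseteq> set q"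
        using btrail_from_apath[OF q False, of "T \<noteq> {p. btrail B r p x}"] T_cases by blast
      then have "p \<in> T"
        using T(1) by blast
      with p show "\<exists>p\<in>T. oedge ` set p \<noteq> {} \<and> entry ` oedge ` set p \<subseteq> set q"
        by (intro bexI[of _ p]) simp_all
    qed
  qed
qed

end

theorem lemma3p12:
  fixes B :: "('v, 'e) bidirected_graph" and D :: "('v, 'e) pre_digraph" and r x :: 'v
  assumes "rooted_bidirected_graph B r"
    and "edge_clean B r"
    and "trail_reachable B r"
    and "D = trail_skeleton B r"
    and "x \<in> verts D"
  shows "lambda_trail B r x = lambda_digraph D r x \<and>
    (path_reachable B r \<longrightarrow> lambda_path B r x = lambda_digraph D r x)"
proof -
  interpret clean_bidirected_graph B r
    using assms(1,2) by (simp add: clean_bidirected_graph_def clean_bidirected_graph_axioms_def)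
  have x: "x \<in> verts (trail_skeleton B r)"
    using assms(4,5) by simp
  show ?thesis
    unfolding assms(4) lambda_trail_def lambda_path_def
    using lambda_skeleton[OF bpaths_subset subset_refl _ x]
      lambda_skeleton[OF subset_refl bpaths_subset _ x] by simp
qed

end
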